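(* Let $E,A\in\mathbb{K}^{n\times n}$ be such that $\operatorname{ran}\begin{bmatrix}E\\ A\end{bmatrix}=\mathcal{D}\mathcal{L}$ for some dissipative linear relation $\mathcal{D}\subseteq\mathbb{K}^{2n}$ and some nonnegative linear relation $\mathcal{L}\subseteq\mathbb{K}^{2n}$. If $sE-A$ is regular, then the following holds: (a) $\sigma(E,A)\subseteq\overline{\mathbb{C}_-}$ and the non-zero eigenvalues on the imaginary axis are semi-simple. The size of the Jordan blocks at $0$ is at most two. (b) The size of the Jordan blocks at $\infty$, i.e. the index, is at most three. (c) If additionally $\mathcal{D}$ is maximally dissipative and $\mathcal{L}=(\operatorname{gr}L)^{-1}$ for some positive definite $L\in\mathbb{K}^{n\times n}$, then $sE-A$ has index at most one and the eigenvalue zero is semi-simple (if zero is an eigenvalue).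
   Context: $\mathbb{K}\in\{\mathbb{R},\mathbb{C}\}$, and $\mathbb{K}^n$ carries the inner product $\langle x,y\rangle=y^*x$. $\overline{\mathbb{C}_-}$ is the closed left half-plane. Positive definite matrices are Hermitian by convention. A linear relation in $\mathbb{K}^n$ is a linear subspace of $\mathbb{K}^{2n}\cong\mathbb{K}^n\times\mathbb{K}^n$. The graph of $M\in\mathbb{K}^{n\times n}$ is $\operatorname{gr}M=\{(x,Mx): x\in\mathbb{K}^n\}$; the inverse is $\mathcal{M}^{-1}=\{(y,x):(x,y)\in\mathcal{M}\}$; the product is $\mathcal{D}\mathcal{L}=\{(x,z) : \exists y\in\mathbb{K}^n,\ (x,y)\in\mathcal{L},\ (y,z)\in\mathcal{D}\}$. The adjoint is $\mathcal{M}^*=\{(x,y)\in\mathbb{K}^{2n} : \langle w,x\rangle=\langle v,y\rangle\ \forall (v,w)\in\mathcal{M}\}$. $\mathcal{M}$ is symmetric if $\mathcal{M}\subseteq\mathcal{M}^*$; dissipative if $\operatorname{Re}\langle x,y\rangle\le 0$ for all $(x,y)\in\mathcal{M}$; nonnegative if it is symmetric and $\langle x,y\rangle\ge0$ for all $(x,y)\in\mathcal{M}$; maximally dissipative if it is dissipative and not a proper subspace of a dissipative linear relation. A square pencil $sE-A\in\mathbb{K}[s]^{n\times n}$ is regular if $\det(sE-A)$ is not the zero polynomial. In this case there are invertible $S,T\in\mathbb{K}^{n\times n}$ with $S(sE-A)T=\operatorname{diag}(sI_{n_0}-J,\ sN-I_{n-n_0})$ (Weierstraß form), where $J$ is in Jordan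 canonical form and $N$ is a block diagonal matrix of nilpotent Jordan blocks. The Jordan blocks at $\infty$ are the blocks of $N$; the index is the size of the largest block of $N$ (and $0$ if $N$ is empty). The set of eigenvalues is $\sigma(E,A)=\{\lambda\in\mathbb{C}:\det(\lambda E-A)=0\}$, and the Jordan blocks of $sE-A$ at $\lambda\in\sigma(E,A)$ are the Jordan blocks of $J$ at $\lambda$ (understood over $\mathbb{C}$); $\lambda$ is semi-simple if none of these has size $\ge2$. *)

theory Defs
  imports
    "HOL-Library.Complex_Order"
    "Jordan_Normal_Form.Matrix"
    "Jordan_Normal_Form.Determinant"
    "Jordan_Normal_Form.Conjugate"
    "Jordan_Normal_Form.Schur_Decomposition"
    "Jordan_Normal_Form.Jordan_Normal_Form"
begin

text \<open>
  The scalar field is a set \<open>K\<close> of complex numbers, either \<open>\<real>\<close> or \<open>UNIV\<close>. Vectors and matrices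
  are complex throughout, with entries in \<open>K\<close>; real matrices are thus complex matrices with real
  entries, and their eigenvalues and Jordan blocks are automatically understood over the complex
  numbers. The inner product \<open>\<langle>x, y\<rangle> = y\<^sup>* x\<close> is the library's \<open>x \<bullet>c y\<close>.
\<close>

definition Kvec :: "complex set \<Rightarrow> nat \<Rightarrow> complex vec set" where
  "Kvec K n = {v \<in> carrier_vec n. \<forall>i<n. v $ i \<in> K}"

definition Kmat :: "complex set \<Rightarrow> nat \<Rightarrow> complex mat set" where
  "Kmat K n = {M \<in> carrier_mat n n. \<forall>i<n. \<forall>j<n. M $$ (i, j) \<in> K}"


section \<open>Linear relations\<close>

type_synonym lrel = "(complex vec \<times> complex vec) set"

definition linear_relation :: "complex set \<Rightarrow> nat \<Rightarrow> lrel \<Rightarrow> bool" where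
  "linear_relation K n M \<longleftrightarrow>
     M \<subseteq> Kvec K n \<times> Kvec K n \<and>
     (0\<^sub>v n, 0\<^sub>v n) \<in> M \<and>
     (\<forall>x y v w. (x, y) \<in> M \<longrightarrow> (v, w) \<in> M \<longrightarrow> (x + v, y + w) \<in> M) \<and>
     (\<forall>c\<in>K. \<forall>x y. (x, y) \<in> M \<longrightarrow> (c \<cdot>\<^sub>v x, c \<cdot>\<^sub>v y) \<in> M)"

definition graph :: "complex set \<Rightarrow> nat \<Rightarrow> complex mat \<Rightarrow> lrel" where
  "graph K n M = {(x, M *\<^sub>v x) | x. x \<in> Kvec K n}"

text \<open>
  The inverse of a relation is the library's converse \<open>M\<inverse>\<close>. The product \<open>D L\<close> applies \<open>L\<close> first, so
  it is the library's diagrammatic composition \<open>L O D\<close>.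
\<close>

definition lrel_prod :: "lrel \<Rightarrow> lrel \<Rightarrow> lrel" where
  "lrel_prod D L = L O D"

definition lrel_adjoint :: "complex set \<Rightarrow> nat \<Rightarrow> lrel \<Rightarrow> lrel" where
  "lrel_adjoint K n M =
     {(x, y). x \<in> Kvec K n \<and> y \<in> Kvec K n \<and> (\<forall>(v, w)\<in>M. w \<bullet>c x = v \<bullet>c y)}"

definition symmetric_relation :: "complex set \<Rightarrow> nat \<Rightarrow> lrel \<Rightarrow> bool" where
  "symmetric_relation K n M \<longleftrightarrow> linear_relation K n M \<and> M \<subseteq> lrel_adjoint K n M"

definition dissipative_relation :: "complex set \<Rightarrow> nat \<Rightarrow> lrel \<Rightarrow> bool" where
  "dissipative_relation K n M \<longleftrightarrow>
     linear_relation K n M \<and> (\<forall>(x, y)\<in>M. Re (x \<bullet>c y) \<le> 0)"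

text \<open>
  In the order on complex numbers used here, \<open>0 \<le> z\<close> and \<open>0 < z\<close> include that \<open>z\<close> is real.
\<close>

definition nonnegative_relation :: "complex set \<Rightarrow> nat \<Rightarrow> lrel \<Rightarrow> bool" where
  "nonnegative_relation K n M \<longleftrightarrow>
     symmetric_relation K n M \<and> (\<forall>(x, y)\<in>M. 0 \<le> x \<bullet>c y)"

definition maximally_dissipative_relation :: "complex set \<Rightarrow> nat \<Rightarrow> lrel \<Rightarrow> bool" where
  "maximally_dissipative_relation K n M \<longleftrightarrow>
     dissipative_relation K n M \<and> \<not> (\<exists>M'. dissipative_relation K n M' \<and> M \<subset> M')"

definition positive_definite :: "complex set \<Rightarrow> nat \<Rightarrow> complex mat \<Rightarrow> bool" where
  "positive_definite K n L \<longleftrightarrow>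
     L \<in> Kmat K n \<and> mat_adjoint L = L \<and>
     (\<forall>x\<in>Kvec K n. x \<noteq> 0\<^sub>v n \<longrightarrow> 0 < (L *\<^sub>v x) \<bullet>c x)"

text \<open>
  The range of the stacked matrix with blocks \<open>E\<close> and \<open>A\<close>, under the identification of \<open>K\<^sup>2\<^sup>n\<close> with
  \<open>K\<^sup>n \<times> K\<^sup>n\<close>.
\<close>

definition stacked_range :: "complex set \<Rightarrow> nat \<Rightarrow> complex mat \<Rightarrow> complex mat \<Rightarrow> lrel" where
  "stacked_range K n E A = {(E *\<^sub>v x, A *\<^sub>v x) | x. x \<in> Kvec K n}"


section \<open>Matrix pencils\<close>

abbreviation const_poly_mat :: "complex mat \<Rightarrow> complex poly mat" where
  "const_poly_mat M \<equiv> map_mat (\<lambda>c. [:c:]) M"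

definition pencil :: "complex mat \<Rightarrow> complex mat \<Rightarrow> complex poly mat" where
  "pencil E A = [:0, 1:] \<cdot>\<^sub>m const_poly_mat E - const_poly_mat A"

definition regular_pencil :: "complex mat \<Rightarrow> complex mat \<Rightarrow> bool" where
  "regular_pencil E A \<longleftrightarrow> det (pencil E A) \<noteq> 0"

definition pencil_eigenvalues :: "complex mat \<Rightarrow> complex mat \<Rightarrow> complex set" where
  "pencil_eigenvalues E A = {\<mu>. det (\<mu> \<cdot>\<^sub>m E - A) = 0}"

text \<open>
  \<open>js\<close> lists the Jordan blocks of \<open>J\<close> as pairs (size, eigenvalue), and \<open>ks\<close> lists the sizes of the
  nilpotent Jordan blocks of \<open>N\<close>. The transformations \<open>S\<close> and \<open>T\<close> are complex also for real
  pencils, since \<open>J\<close> may have non-real eigenvalues.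
\<close>

definition weierstrass_form ::
  "nat \<Rightarrow> complex mat \<Rightarrow> complex mat \<Rightarrow> (nat \<times> complex) list \<Rightarrow> nat list \<Rightarrow> bool" where
  "weierstrass_form n E A js ks \<longleftrightarrow>
     0 \<notin> fst ` set js \<and> 0 \<notin> set ks \<and>
     (\<exists>S T. S \<in> carrier_mat n n \<and> T \<in> carrier_mat n n \<and>
        invertible_mat S \<and> invertible_mat T \<and>
        (let J = jordan_matrix js; N = jordan_matrix (map (\<lambda>k. (k, 0)) ks) in
           const_poly_mat S * pencil E A * const_poly_mat T =
             diag_block_mat [pencil (1\<^sub>m (dim_row J)) J, pencil N (1\<^sub>m (dim_row N))]))"

text \<open>
  The Weierstrass form of a regular pencil exists and is unique up to the order of the blocks, so
  the following notions do not depend on the choice of the form.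
\<close>

definition jordan_block_at :: "nat \<Rightarrow> complex mat \<Rightarrow> complex mat \<Rightarrow> complex \<Rightarrow> nat \<Rightarrow> bool" where
  "jordan_block_at n E A \<mu> k \<longleftrightarrow> (\<exists>js ks. weierstrass_form n E A js ks \<and> (k, \<mu>) \<in> set js)"

definition jordan_block_at_infinity :: "nat \<Rightarrow> complex mat \<Rightarrow> complex mat \<Rightarrow> nat \<Rightarrow> bool" where
  "jordan_block_at_infinity n E A k \<longleftrightarrow> (\<exists>js ks. weierstrass_form n E A js ks \<and> k \<in> set ks)"

definition semi_simple :: "nat \<Rightarrow> complex mat \<Rightarrow> complex mat \<Rightarrow> complex \<Rightarrow> bool" where
  "semi_simple n E A \<mu> \<longleftrightarrow> \<not> (\<exists>k\<ge>2. jordan_block_at n E A \<mu> k)"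

definition pencil_index :: "nat \<Rightarrow> complex mat \<Rightarrow> complex mat \<Rightarrow> nat" where
  "pencil_index n E A = Max (insert 0 {k. jordan_block_at_infinity n E A k})"

end

theory Submission
  imports Defs
begin

text \<open>
  Write \<open>(E x, y) \<in> L\<close> and \<open>(y, A x) \<in> D\<close> for a link \<open>y\<close> of \<open>x\<close>. Along a Jordan chain that is longer than
  claimed, symmetry of \<open>L\<close> forces the forms \<open>\<langle>E x, y\<rangle>\<close> and \<open>Re \<langle>y, A x\<rangle>\<close> to vanish at the first vectors of the
  chain. By Cauchy--Schwarz such isotropic pairs are orthogonal to the whole relation, so their links
  are orthogonal to the ranges of \<open>E\<close> and \<open>A\<close>, hence zero by regularity. What remains is a vector \<open>z \<noteq> 0\<close>
  with \<open>(z, 0) \<in> L\<close> and \<open>(0, z) \<in> D\<close>, which is impossible for a regular pencil because the stacked range is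
  all of \<open>D L\<close>. The real case is reduced to the complex one by complexifying both relations.
\<close>

section \<open>The inner product\<close>

lemma cinner_add_left:
  fixes x y z :: "complex vec"
  assumes "x \<in> carrier_vec n" "y \<in> carrier_vec n" "z \<in> carrier_vec n"
  shows "(x + y) \<bullet>c z = x \<bullet>c z + y \<bullet>c z"
  using assms by (auto intro!: add_scalar_prod_distrib)

lemma cinner_add_right:
  fixes x y z :: "complex vec"
  assumes "x \<in> carrier_vec n" "y \<in> carrier_vec n" "z \<in> carrier_vec n"
  shows "x \<bullet>c (y + z) = x \<bullet>c y + x \<bullet>c z"
  using assms by (subst conjugate_add_vec) (auto intro!: scalar_prod_add_distrib)

lemma cinner_smult_left:
  fixes x y :: "complex vec"
  assumes "x \<in> carrier_vec n" "y \<in> carrier_vec n"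
  shows "(c \<cdot>\<^sub>v x) \<bullet>c y = c * (x \<bullet>c y)"
  using assms by (auto intro!: smult_scalar_prod_distrib)

lemma cinner_smult_right:
  fixes x y :: "complex vec"
  assumes "x \<in> carrier_vec n" "y \<in> carrier_vec n"
  shows "x \<bullet>c (c \<cdot>\<^sub>v y) = cnj c * (x \<bullet>c y)"
  using assms by (simp add: conjugate_smult_vec)

lemma cnj_cinner:
  fixes x y :: "complex vec"
  assumes "x \<in> carrier_vec n" "y \<in> carrier_vec n"
  shows "cnj (x \<bullet>c y) = y \<bullet>c x"
  using assms by (auto simp: scalar_prod_def mult.commute intro!: sum.cong)

text \<open>If \<open>b\<close> were nonzero, some complex \<open>t\<close> would give
  \<open>t * b = 1 - a\<close> and push the left side up to 1. This is the form of Cauchy-Schwarz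
  used for isotropic pairs, where the quadratic term contributes nothing and only a linear term in
  \<open>t\<close> remains.\<close>

lemma real_le_zero_slope:
  fixes b :: complex
  assumes "\<And>t. a + Re (t * b) \<le> 0"
  shows "b = 0"
proof (rule ccontr)
  assume "b \<noteq> 0"
  then have "(1 - a) / b * b = 1 - a" by simp
  with assms[of "(1 - a) / b"] show False by simp
qed


section \<open>Jordan chains from the Weierstrass form\<close>

text \<open>Induction on the list of blocks: the offset \<open>p\<close> is 0 for the head and
  otherwise grows by the size of the head. The entries are given for all rows \<open>i\<close>, so
  that whole columns are determined; \<open>0 < j\<close> keeps the first column of the block free
  of a superdiagonal 1.\<close>

lemma jordan_matrix_block:
  assumes "(k, a) \<in> set js"
  obtains p where "p + k \<le> sum_list (map fst js)"
    and "\<And>i j. i < sum_list (map fst js) \<Longrightarrow> j < k \<Longrightarrow>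
      jordan_matrix js $$ (i, p + j) = (if i = p + j then a else if 0 < j \<and> Suc i = p + j then 1 else 0)"
proof -
  have "\<exists>p. p + k \<le> sum_list (map fst js) \<and> (\<forall>i j. i < sum_list (map fst js) \<longrightarrow> j < k \<longrightarrow>
      jordan_matrix js $$ (i, p + j) = (if i = p + j then a else if 0 < j \<and> Suc i = p + j then 1 else 0))"
    using assms
  proof (induction js)
    case Nil
    then show ?case by simp
  next
    case (Cons b js)
    obtain l c where b: "b = (l, c)" by force
    let ?d = "sum_list (map fst js)"
    have jm: "jordan_matrix (b # js) =
        four_block_mat (jordan_block l c) (0\<^sub>m l ?d) (0\<^sub>m ?d l) (jordan_matrix js)"
      using jordan_matrix_dim[of js] unfolding b by (simp add: jordan_matrix_def Let_def)
    show ?case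
    proof (cases "b = (k, a)")
      case True
      then show ?thesis
        unfolding jm using b by (intro exI[of _ 0]) auto
    next
      case False
      then obtain p where p: "p + k \<le> ?d"
        and e: "\<And>i j. i < ?d \<Longrightarrow> j < k \<Longrightarrow>
          jordan_matrix js $$ (i, p + j) = (if i = p + j then a else if 0 < j \<and> Suc i = p + j then 1 else 0)"
        using Cons by auto
      show ?thesis
      proof (intro exI[of _ "l + p"] conjI allI impI)
        show "l + p + k \<le> sum_list (map fst (b # js))" using p b by simp
        fix i j
        assume i: "i < sum_list (map fst (b # js))" and j: "j < k"
        show "jordan_matrix (b # js) $$ (i, l + p + j) =
            (if i = l + p + j then a else if 0 < j \<and> Suc i = l + p + j then 1 else 0)"
        proof (cases "i < l")
          case True
          then show ?thesis unfolding jm using p b i j by (auto simp: jordan_block_def)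
        next
          case False
          then obtain i' where i': "i = l + i'" using le_Suc_ex not_less by blast
          then show ?thesis unfolding jm using e[of i' j] p b i j by auto
        qed
      qed
    qed
  qed
  then show ?thesis using that by blast
qed

lemma pencil_carrier [simp]:
  "E \<in> carrier_mat n n \<Longrightarrow> A \<in> carrier_mat n n \<Longrightarrow> pencil E A \<in> carrier_mat n n"
  by (auto simp: pencil_def)

lemma poly_pencil:
  assumes "E \<in> carrier_mat n n" "A \<in> carrier_mat n n"
  shows "map_mat (\<lambda>p. poly p s) (pencil E A) = s \<cdot>\<^sub>m E - A"
  using assms by (intro eq_matI) (auto simp: pencil_def)

lemma poly_eval_hom: "comm_ring_hom (\<lambda>p :: complex poly. poly p s)"
  by unfold_locales

lemma poly_eval_semiring_hom: "semiring_hom (\<lambda>p :: complex poly. poly p s)"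
  by unfold_locales

lemma poly_pencil_transform:
  assumes "E \<in> carrier_mat n n" "A \<in> carrier_mat n n" "S \<in> carrier_mat n n" "T \<in> carrier_mat n n"
  shows "map_mat (\<lambda>p. poly p s) (const_poly_mat S * pencil E A * const_poly_mat T)
    = S * (s \<cdot>\<^sub>m E - A) * T"
proof -
  have "map_mat (\<lambda>p. poly p s) (const_poly_mat M) = M" for M :: "complex mat"
    by (intro eq_matI) auto
  then show ?thesis
    using assms by (simp add: semiring_hom.mat_hom_mult[OF poly_eval_semiring_hom,of _ n n _ n] poly_pencil[of _ n])
qed

lemma det_pencil_eval:
  assumes "E \<in> carrier_mat n n" "A \<in> carrier_mat n n"
  shows "poly (det (pencil E A)) s = det (s \<cdot>\<^sub>m E - A)"
proof -
  show ?thesis using comm_ring_hom.hom_det[OF poly_eval_hom, of s "pencil E A"] assms by (simp add: poly_pencil)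
qed

text \<open>Evaluating the polynomial identity at scalars and moving \<open>S\<close> to the other
  side as its inverse \<open>R\<close> leaves two constant matrix equations that can be read column
  by column. The invertibility of \<open>T\<close> enters through its nonzero columns, which supply
  the nonzero first vector of a chain.\<close>

lemma weierstrass_formE:
  assumes W: "weierstrass_form n E A js ks" and E: "E \<in> carrier_mat n n" and A: "A \<in> carrier_mat n n"
  obtains R T where "R \<in> carrier_mat n n" "T \<in> carrier_mat n n"
    and "\<And>j. j < n \<Longrightarrow> col T j \<noteq> 0\<^sub>v n"
    and "sum_list (map fst js) + sum_list ks = n"
    and "E * T = R * four_block_mat (1\<^sub>m (sum_list (map fst js)))
      (0\<^sub>m (sum_list (map fst js)) (sum_list ks)) (0\<^sub>m (sum_list ks) (sum_list (map fst js)))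
      (jordan_matrix (map (\<lambda>k. (k, 0)) ks))"
    and "A * T = R * four_block_mat (jordan_matrix js)
      (0\<^sub>m (sum_list (map fst js)) (sum_list ks)) (0\<^sub>m (sum_list ks) (sum_list (map fst js)))
      (1\<^sub>m (sum_list ks))"
proof -
  let ?a = "sum_list (map fst js)" and ?b = "sum_list ks"
  let ?J = "jordan_matrix js" and ?N = "jordan_matrix (map (\<lambda>k. (k, 0)) ks) :: complex mat"
  have dN: "?N \<in> carrier_mat ?b ?b"
    using jordan_matrix_carrier[of "map (\<lambda>k. (k, 0::complex)) ks"] by (simp add: o_def)
  have dJ: "?J \<in> carrier_mat ?a ?a" by simp
  obtain S T where S: "S \<in> carrier_mat n n" and T: "T \<in> carrier_mat n n"
    and iS: "invertible_mat S" and iT: "invertible_mat T"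
    and eq: "const_poly_mat S * pencil E A * const_poly_mat T =
      diag_block_mat [pencil (1\<^sub>m ?a) ?J, pencil ?N (1\<^sub>m ?b)]"
    using W unfolding weierstrass_form_def Let_def carrier_matD(1)[OF dN] carrier_matD(1)[OF dJ] by blast
  obtain R where R: "R * S = 1\<^sub>m n" "R \<in> carrier_mat n n"
  proof -
    from iS obtain R where "S * R = 1\<^sub>m n" "R * S = 1\<^sub>m (dim_row R)"
      using S unfolding invertible_mat_def inverts_mat_def by auto
    moreover from this have "R \<in> carrier_mat n n"
      by (metis S carrier_matD(2) carrier_mat_triv index_mult_mat(2,3) index_one_mat(2,3))
    ultimately show ?thesis using that by auto
  qed
  obtain Q where Q: "Q * T = 1\<^sub>m n" "Q \<in> carrier_mat n n"
  proof -
    from iT obtain Q where "T * Q = 1\<^sub>m n" "Q * T = 1\<^sub>m (dim_row Q)"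
      using T unfolding invertible_mat_def inverts_mat_def by auto
    moreover from this have "Q \<in> carrier_mat n n"
      by (metis T carrier_matD(2) carrier_mat_triv index_mult_mat(2,3) index_one_mat(2,3))
    ultimately show ?thesis using that by auto
  qed
  have pJ: "pencil (1\<^sub>m ?a) ?J \<in> carrier_mat ?a ?a" and pN: "pencil ?N (1\<^sub>m ?b) \<in> carrier_mat ?b ?b"
    using dN dJ by auto
  have D: "diag_block_mat [pencil (1\<^sub>m ?a) ?J, pencil ?N (1\<^sub>m ?b)] =
      four_block_mat (pencil (1\<^sub>m ?a) ?J) (0\<^sub>m ?a ?b) (0\<^sub>m ?b ?a) (pencil ?N (1\<^sub>m ?b))"
    unfolding diag_block_mat.simps(2)[of "pencil (1\<^sub>m ?a) ?J"] diag_block_mat_singleton Let_def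
    by (simp add: carrier_matD[OF pJ] carrier_matD[OF pN])
  \<comment> \<open>\<open>weierstrass_form\<close> does not state the total size of the blocks; it
    is read off from the row dimensions of the two sides.\<close>
  have n: "?a + ?b = n"
    using arg_cong[OF eq, of dim_row] S pJ pN unfolding D by simp
  define F where "F = four_block_mat (1\<^sub>m ?a) (0\<^sub>m ?a ?b) (0\<^sub>m ?b ?a) ?N"
  define G where "G = four_block_mat ?J (0\<^sub>m ?a ?b) (0\<^sub>m ?b ?a) (1\<^sub>m ?b)"
  have F: "F \<in> carrier_mat n n" and G: "G \<in> carrier_mat n n"
    using dJ dN n by (auto simp: F_def G_def)
  have ev: "S * (s \<cdot>\<^sub>m E - A) * T = s \<cdot>\<^sub>m F - G" for s
    unfolding poly_pencil_transform[OF E A S T, symmetric] eq D using dJ dN F G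
    by (intro eq_matI) (auto simp: F_def G_def pencil_def)
  have ev': "(s \<cdot>\<^sub>m E - A) * T = R * (s \<cdot>\<^sub>m F - G)" for s
  proof -
    have "R * (S * ((s \<cdot>\<^sub>m E - A) * T)) = (R * S) * ((s \<cdot>\<^sub>m E - A) * T)"
      by (rule assoc_mult_mat[symmetric, of _ n n _ n _ n]) (use S T R E A in auto)
    also have "S * ((s \<cdot>\<^sub>m E - A) * T) = s \<cdot>\<^sub>m F - G"
      using assoc_mult_mat[OF S minus_carrier_mat[OF A] T, of "s \<cdot>\<^sub>m E"] ev by simp
    finally show ?thesis using R T E A by simp
  qed
  have lin: "s \<cdot>\<^sub>m (E * T) - A * T = s \<cdot>\<^sub>m (R * F) - R * G" for s
    using ev'[of s] E A T R F G
    by (simp add: minus_mult_distrib_mat[of _ n n _ _ n] mult_minus_distrib_mat[of _ n n _ n]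
        mult_smult_assoc_mat[of _ n n _ n] mult_smult_distrib[of _ n n _ n])
  have ent: "s * (E * T) $$ (i, j) - (A * T) $$ (i, j) = s * (R * F) $$ (i, j) - (R * G) $$ (i, j)"
    if "i < n" "j < n" for i j s
    using arg_cong[OF lin, of "\<lambda>M. M $$ (i, j)" s] that E A T R F G by (simp del: index_mult_mat(1))
  \<comment> \<open>Both sides of \<open>ent\<close> are affine in \<open>s\<close>: the value at 0
    yields the constant coefficients, and with them the value at 1 yields the leading ones.\<close>
  have AT: "A * T = R * G"
    by (rule eq_matI) (use ent[of _ _ 0] A T R G in \<open>auto simp del: index_mult_mat(1)\<close>)
  have ET: "E * T = R * F"
    by (rule eq_matI) (use ent[of _ _ 1] AT E T R F in \<open>auto simp del: index_mult_mat(1)\<close>)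
  have "col T j \<noteq> 0\<^sub>v n" if "j < n" for j
  proof
    assume "col T j = 0\<^sub>v n"
    then have "unit_vec n j = Q *\<^sub>v 0\<^sub>v n"
      using col_mult2[OF Q(2) T that] that Q by simp
    also have "\<dots> = 0\<^sub>v n" using Q(2) by (intro eq_vecI) auto
    finally show False using that by (metis index_unit_vec(2) index_zero_vec(1) zero_neq_one)
  qed
  with that[OF R(2) T _ n] ET AT show ?thesis unfolding F_def G_def by blast
qed

text \<open>The chain consists of the columns of \<open>T\<close> at the positions of the block.
  There the columns of \<open>?F\<close> are unit vectors, and those of \<open>?G\<close> are
  \<open>\<mu>\<close> times a unit vector plus, except for the first, the preceding unit vector;
  applying \<open>R\<close> gives the chain equations.\<close>

lemma jordan_chain:
  assumes J: "jordan_block_at n E A \<mu> k" and E: "E \<in> carrier_mat n n" and A: "A \<in> carrier_mat n n"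
  obtains x where "\<forall>j<k. x j \<in> carrier_vec n" "x 0 \<noteq> 0\<^sub>v n"
    "A *\<^sub>v x 0 = \<mu> \<cdot>\<^sub>v (E *\<^sub>v x 0)"
    "\<forall>j. Suc j < k \<longrightarrow> A *\<^sub>v x (Suc j) = \<mu> \<cdot>\<^sub>v (E *\<^sub>v x (Suc j)) + E *\<^sub>v x j"
proof -
  obtain js ks where W: "weierstrass_form n E A js ks" and k: "(k, \<mu>) \<in> set js"
    using J unfolding jordan_block_at_def by auto
  have k0: "0 < k" using W k unfolding weierstrass_form_def by force
  let ?a = "sum_list (map fst js)" and ?b = "sum_list ks"
  let ?F = "four_block_mat (1\<^sub>m ?a) (0\<^sub>m ?a ?b) (0\<^sub>m ?b ?a)
      (jordan_matrix (map (\<lambda>k. (k, 0)) ks)) :: complex mat"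
  let ?G = "four_block_mat (jordan_matrix js) (0\<^sub>m ?a ?b) (0\<^sub>m ?b ?a) (1\<^sub>m ?b)"
  obtain R T where R: "R \<in> carrier_mat n n" and T: "T \<in> carrier_mat n n"
    and Tn: "\<And>j. j < n \<Longrightarrow> col T j \<noteq> 0\<^sub>v n"
    and n: "?a + ?b = n" and ET: "E * T = R * ?F" and AT: "A * T = R * ?G"
    using weierstrass_formE[OF W E A] by blast
  have dN: "jordan_matrix (map (\<lambda>k. (k, 0::complex)) ks) \<in> carrier_mat ?b ?b"
    using jordan_matrix_carrier[of "map (\<lambda>k. (k, 0::complex)) ks"] by (simp add: o_def)
  have F: "?F \<in> carrier_mat n n" and G: "?G \<in> carrier_mat n n" using n dN by auto
  obtain p where p: "p + k \<le> ?a" and blk: "\<And>i j. i < ?a \<Longrightarrow> j < k \<Longrightarrow>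
      jordan_matrix js $$ (i, p + j) = (if i = p + j then \<mu> else if 0 < j \<and> Suc i = p + j then 1 else 0)"
    using jordan_matrix_block[OF k] by blast
  have cF: "col ?F (p + j) = unit_vec n (p + j)" if "j < k" for j
    using that p n dN by (intro eq_vecI) (auto simp: unit_vec_def)
  have cG0: "col ?G p = \<mu> \<cdot>\<^sub>v unit_vec n p"
    using p n blk[of _ 0] k0 by (intro eq_vecI) (auto simp: unit_vec_def)
  have cG: "col ?G (p + Suc j) = \<mu> \<cdot>\<^sub>v unit_vec n (p + Suc j) + unit_vec n (p + j)" if "Suc j < k" for j
    using p n blk[of _ "Suc j"] that by (intro eq_vecI) (auto simp: unit_vec_def)
  define x where "x j = col T (p + j)" for j
  have Ex: "E *\<^sub>v x j = R *\<^sub>v unit_vec n (p + j)" if "j < k" for j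
    using col_mult2[OF E T, of "p + j"] col_mult2[OF R F, of "p + j"] cF[OF that] that p n
    by (simp add: x_def ET)
  have Ax: "A *\<^sub>v x j = R *\<^sub>v col ?G (p + j)" if "j < k" for j
    using col_mult2[OF A T, of "p + j"] col_mult2[OF R G, of "p + j"] that p n
    by (simp add: x_def AT)
  show ?thesis
  proof (rule that[of x])
    show "\<forall>j<k. x j \<in> carrier_vec n" using T by (auto simp: x_def)
    show "x 0 \<noteq> 0\<^sub>v n" using Tn p n k0 by (auto simp: x_def)
    show "A *\<^sub>v x 0 = \<mu> \<cdot>\<^sub>v (E *\<^sub>v x 0)"
      using Ax[OF k0] Ex[OF k0] cG0 R by (simp add: mult_mat_vec)
    have "A *\<^sub>v x (Suc j) = \<mu> \<cdot>\<^sub>v (E *\<^sub>v x (Suc j)) + E *\<^sub>v x j" if "Suc j < k" for j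
      using Ax[OF that] Ex[OF that] Ex[of j] cG[OF that] that R
      by (simp add: mult_mat_vec mult_add_distrib_mat_vec[of _ n n])
    then show "\<forall>j. Suc j < k \<longrightarrow> A *\<^sub>v x (Suc j) = \<mu> \<cdot>\<^sub>v (E *\<^sub>v x (Suc j)) + E *\<^sub>v x j" by blast
  qed
qed

text \<open>The roles of \<open>?F\<close> and \<open>?G\<close> are exchanged: at these positions
  the identity stands in \<open>?G\<close> and the nilpotent block in \<open>?F\<close>, so it is
  \<open>E\<close> that shifts along the chain and kills its first vector.\<close>

lemma jordan_chain_at_infinity:
  assumes J: "jordan_block_at_infinity n E A k" and E: "E \<in> carrier_mat n n" and A: "A \<in> carrier_mat n n"
  obtains x where "\<forall>j<k. x j \<in> carrier_vec n" "x 0 \<noteq> 0\<^sub>v n"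
    "E *\<^sub>v x 0 = 0\<^sub>v n"
    "\<forall>j. Suc j < k \<longrightarrow> E *\<^sub>v x (Suc j) = A *\<^sub>v x j"
proof -
  obtain js ks where W: "weierstrass_form n E A js ks" and k: "k \<in> set ks"
    using J unfolding jordan_block_at_infinity_def by auto
  have k0: "0 < k" using W k unfolding weierstrass_form_def by (metis gr0I)
  let ?a = "sum_list (map fst js)" and ?b = "sum_list ks"
  let ?N = "jordan_matrix (map (\<lambda>k. (k, 0)) ks) :: complex mat"
  let ?F = "four_block_mat (1\<^sub>m ?a) (0\<^sub>m ?a ?b) (0\<^sub>m ?b ?a) ?N"
  let ?G = "four_block_mat (jordan_matrix js) (0\<^sub>m ?a ?b) (0\<^sub>m ?b ?a) (1\<^sub>m ?b)"
  obtain R T where R: "R \<in> carrier_mat n n" and T: "T \<in> carrier_mat n n"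
    and Tn: "\<And>j. j < n \<Longrightarrow> col T j \<noteq> 0\<^sub>v n"
    and n: "?a + ?b = n" and ET: "E * T = R * ?F" and AT: "A * T = R * ?G"
    using weierstrass_formE[OF W E A] by blast
  have dN: "?N \<in> carrier_mat ?b ?b"
    using jordan_matrix_carrier[of "map (\<lambda>k. (k, 0::complex)) ks"] by (simp add: o_def)
  have F: "?F \<in> carrier_mat n n" and G: "?G \<in> carrier_mat n n" using n dN by auto
  have k': "(k, 0) \<in> set (map (\<lambda>k. (k, 0::complex)) ks)" using k by auto
  obtain p where p: "p + k \<le> ?b" and blk: "\<And>i j. i < ?b \<Longrightarrow> j < k \<Longrightarrow>
      ?N $$ (i, p + j) = (if 0 < j \<and> Suc i = p + j then 1 else 0)"
  proof (rule jordan_matrix_block[OF k'])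
    fix p
    assume "p + k \<le> sum_list (map fst (map (\<lambda>k. (k, 0::complex)) ks))"
      and "\<And>i j. i < sum_list (map fst (map (\<lambda>k. (k, 0::complex)) ks)) \<Longrightarrow> j < k \<Longrightarrow>
        ?N $$ (i, p + j) = (if i = p + j then 0 else if 0 < j \<and> Suc i = p + j then 1 else 0)"
    then show thesis by (intro that[of p]) (auto simp: o_def)
  qed
  \<comment> \<open>The infinite part follows the \<open>?a\<close> columns of \<open>J\<close>, so
    the offset \<open>p\<close> inside \<open>?N\<close> has to be shifted.\<close>
  let ?q = "?a + p"
  have cG: "col ?G (?q + j) = unit_vec n (?q + j)" if "j < k" for j
    using that p n by (intro eq_vecI) (auto simp: unit_vec_def)
  have cF0: "col ?F ?q = 0\<^sub>v n"
    using p n dN blk[of _ 0] k0 by (intro eq_vecI) auto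
  have cF: "col ?F (?q + Suc j) = unit_vec n (?q + j)" if "Suc j < k" for j
  proof (rule eq_vecI)
    fix i assume "i < dim_vec (unit_vec n (?q + j))"
    then have "i < n" by simp
    moreover have "?q + Suc j < n" using p n that by linarith
    moreover from calculation have "col ?F (?q + Suc j) $ i = ?F $$ (i, ?q + Suc j)"
      using F by (intro index_col) auto
    moreover have "?F $$ (i, ?q + Suc j) = (if i < ?a then 0 else ?N $$ (i - ?a, p + Suc j))"
      using calculation(1,2) dN n by auto
    ultimately show "col ?F (?q + Suc j) $ i = unit_vec n (?q + j) $ i"
      using blk[of "i - ?a" "Suc j"] that p n by (auto simp: unit_vec_def)
  qed (use carrier_matD[OF F] in simp)
  define x where "x j = col T (?q + j)" for j
  have Ex: "E *\<^sub>v x j = R *\<^sub>v col ?F (?q + j)" if "j < k" for j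
    using col_mult2[OF E T, of "?q + j"] col_mult2[OF R F, of "?q + j"] that p n
    by (simp add: x_def ET)
  have Ax: "A *\<^sub>v x j = R *\<^sub>v unit_vec n (?q + j)" if "j < k" for j
    using col_mult2[OF A T, of "?q + j"] col_mult2[OF R G, of "?q + j"] cG[OF that] that p n
    by (simp add: x_def AT)
  show ?thesis
  proof (rule that[of x])
    show "\<forall>j<k. x j \<in> carrier_vec n" using T by (auto simp: x_def)
    show "x 0 \<noteq> 0\<^sub>v n" using Tn p n k0 by (auto simp: x_def)
    show "E *\<^sub>v x 0 = 0\<^sub>v n"
      using Ex[OF k0] cF0 R by (intro eq_vecI) auto
    have "E *\<^sub>v x (Suc j) = A *\<^sub>v x j" if "Suc j < k" for j
      using Ex[OF that] Ax[of j] cF[OF that] that by simp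
    then show "\<forall>j. Suc j < k \<longrightarrow> E *\<^sub>v x (Suc j) = A *\<^sub>v x j" by blast
  qed
qed


section \<open>Regular pencils with a dissipative-nonnegative range\<close>

lemma Kvec_UNIV [simp]: "Kvec UNIV n = carrier_vec n"
  by (auto simp: Kvec_def)

lemma linear_relationD:
  assumes "linear_relation K n M"
  shows "M \<subseteq> Kvec K n \<times> Kvec K n" "(0\<^sub>v n, 0\<^sub>v n) \<in> M"
    "(x, y) \<in> M \<Longrightarrow> (v, w) \<in> M \<Longrightarrow> (x + v, y + w) \<in> M"
    "c \<in> K \<Longrightarrow> (x, y) \<in> M \<Longrightarrow> (c \<cdot>\<^sub>v x, c \<cdot>\<^sub>v y) \<in> M"
  using assms by (simp_all only: linear_relation_def)

lemma linear_relation_Kvec: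
  assumes "linear_relation K n M" "(x, y) \<in> M"
  shows "x \<in> Kvec K n" "y \<in> Kvec K n"
  using subsetD[OF linear_relationD(1)[OF assms(1)] assms(2)] by simp_all

lemma dissipativeD:
  assumes "dissipative_relation K n D"
  shows "linear_relation K n D" "(y, z) \<in> D \<Longrightarrow> Re (y \<bullet>c z) \<le> 0"
  using assms by (auto simp: dissipative_relation_def)

lemma nonnegativeD:
  assumes "nonnegative_relation K n L"
  shows "linear_relation K n L" "(x, y) \<in> L \<Longrightarrow> 0 \<le> x \<bullet>c y"
    "(x, y) \<in> L \<Longrightarrow> (v, w) \<in> L \<Longrightarrow> w \<bullet>c x = v \<bullet>c y"
proof -
  have L: "linear_relation K n L" "L \<subseteq> lrel_adjoint K n L" "\<forall>(x, y)\<in>L. 0 \<le> x \<bullet>c y"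
    using assms unfolding nonnegative_relation_def symmetric_relation_def by auto
  then show "linear_relation K n L" by simp
  show "0 \<le> x \<bullet>c y" if "(x, y) \<in> L" using bspec[OF L(3) that] by simp
  show "w \<bullet>c x = v \<bullet>c y" if xy: "(x, y) \<in> L" and vw: "(v, w) \<in> L"
  proof -
    have "\<forall>(v, w)\<in>L. w \<bullet>c x = v \<bullet>c y" using subsetD[OF L(2) xy] by (simp add: lrel_adjoint_def)
    from bspec[OF this vw] show ?thesis by simp
  qed
qed

lemma smult_zero_vec [simp]: "(c :: complex) \<cdot>\<^sub>v 0\<^sub>v n = 0\<^sub>v n"
  by (intro eq_vecI) auto

text \<open>The setting is complex throughout, because eigenvectors and Jordan chains are complex
  even for a real pencil. Real relations enter through \<open>complexify\<close>.\<close>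

locale dissipative_pencil =
  fixes n :: nat and E A :: "complex mat" and D L :: lrel
  assumes E: "E \<in> carrier_mat n n" and A: "A \<in> carrier_mat n n"
    and dissipative: "dissipative_relation UNIV n D"
    and nonnegative: "nonnegative_relation UNIV n L"
    and range_eq: "stacked_range UNIV n E A = lrel_prod D L"
    and regular: "regular_pencil E A"
begin

lemmas D_linear = dissipativeD(1)[OF dissipative]
  and D_le = dissipativeD(2)[OF dissipative]
  and L_linear = nonnegativeD(1)[OF nonnegative]
  and L_ge = nonnegativeD(2)[OF nonnegative]
  and L_sym = nonnegativeD(3)[OF nonnegative]

lemmas D_carrier = linear_relation_Kvec[OF D_linear, unfolded Kvec_UNIV]
  and L_carrier = linear_relation_Kvec[OF L_linear, unfolded Kvec_UNIV]
  and zero_mem = linear_relationD(2)[OF D_linear] linear_relationD(2)[OF L_linear]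

section \<open>Isotropic pairs and orthogonality\<close>

lemma D_combine: "(x, y) \<in> D \<Longrightarrow> (v, w) \<in> D \<Longrightarrow> (x + c \<cdot>\<^sub>v v, y + c \<cdot>\<^sub>v w) \<in> D"
  by (intro linear_relationD(3,4)[OF D_linear] UNIV_I)

lemma L_combine: "(x, y) \<in> L \<Longrightarrow> (v, w) \<in> L \<Longrightarrow> (x + c \<cdot>\<^sub>v v, y + c \<cdot>\<^sub>v w) \<in> L"
  by (intro linear_relationD(3,4)[OF L_linear] UNIV_I)

text \<open>Along \<open>(v, w) + t (z, y)\<close> the form of \<open>L\<close> stays nonnegative
  and its quadratic term vanishes, so the linear term must vanish as well. Symmetry of
  \<open>L\<close> makes the two cross terms conjugate, hence each of them is zero.\<close>

lemma isotropic_L: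
  assumes zy: "(z, y) \<in> L" and 0: "z \<bullet>c y = 0" and vw: "(v, w) \<in> L"
  shows "v \<bullet>c y = 0"
proof -
  note c = L_carrier[OF zy] L_carrier[OF vw]
  \<comment> \<open>The cross terms add up to \<open>2 * Re (t * (z \<bullet>c w))\<close>; division
    by \<open>-2\<close> gives the shape of \<open>real_le_zero_slope\<close>.\<close>
  have "- Re (v \<bullet>c w) / 2 + Re (t * - (z \<bullet>c w)) \<le> 0" for t
  proof -
    have "0 \<le> Re ((v + t \<cdot>\<^sub>v z) \<bullet>c (w + t \<cdot>\<^sub>v y))"
      using L_ge[OF L_combine[OF vw zy]] by (simp add: less_eq_complex_def)
    also have "(v + t \<cdot>\<^sub>v z) \<bullet>c (w + t \<cdot>\<^sub>v y) = v \<bullet>c w + t * (z \<bullet>c w) + cnj (t * cnj (v \<bullet>c y))"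
      using c 0 by (simp add: cinner_add_left[of _ n] cinner_add_right[of _ n]
          cinner_smult_left[of _ n] cinner_smult_right[of _ n])
    also have "cnj (v \<bullet>c y) = z \<bullet>c w"
      using L_sym[OF vw zy] cnj_cinner[OF c(3,2)] by simp
    finally show ?thesis by simp
  qed
  then have "z \<bullet>c w = 0" using real_le_zero_slope[of "- Re (v \<bullet>c w) / 2" "- (z \<bullet>c w)"] by simp
  then show ?thesis using L_sym[OF vw zy] cnj_cinner[OF c(3,2)] by simp
qed

text \<open>The perturbation argument of \<open>isotropic_L\<close> without symmetry: only the sum
  of the cross terms is forced to vanish, so orthogonality is replaced by a skew relation between
  the two pairs.\<close>

lemma isotropic_D:
  assumes yz: "(y, z) \<in> D" and 0: "Re (y \<bullet>c z) = 0" and vw: "(v, w) \<in> D"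
  shows "v \<bullet>c z = - cnj (y \<bullet>c w)"
proof -
  note c = D_carrier[OF yz] D_carrier[OF vw]
  have "Re (v \<bullet>c w) + Re (t * (y \<bullet>c w + cnj (v \<bullet>c z))) \<le> 0" for t
  proof -
    have e: "(v + t \<cdot>\<^sub>v y) \<bullet>c (w + t \<cdot>\<^sub>v z)
        = v \<bullet>c w + t * (y \<bullet>c w) + cnj (t * cnj (v \<bullet>c z)) + t * cnj t * (y \<bullet>c z)"
      using c by (simp add: cinner_add_left[of _ n] cinner_add_right[of _ n]
          cinner_smult_left[of _ n] cinner_smult_right[of _ n] algebra_simps)
    \<comment> \<open>\<open>t * cnj t\<close> is real, so it is enough that the real part of
      \<open>y \<bullet>c z\<close> vanishes.\<close>
    have "Re (t * cnj t * (y \<bullet>c z)) = 0"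
      using 0 by (simp add: complex_mult_cnj)
    then show ?thesis
      using D_le[OF D_combine[OF vw yz, of t]] unfolding e
      by (simp only: plus_complex.sel complex_cnj distrib_left complex.sel
          complex_cnj_mult complex_cnj_cnj cnj.sel) simp
  qed
  then have "y \<bullet>c w + cnj (v \<bullet>c z) = 0" by (rule real_le_zero_slope)
  then show ?thesis by (metis add_eq_0_iff complex_cnj_cnj complex_cnj_minus)
qed

section \<open>Links and consequences of regularity\<close>

lemma linkE:
  assumes "x \<in> carrier_vec n"
  obtains y where "(E *\<^sub>v x, y) \<in> L" "(y, A *\<^sub>v x) \<in> D"
proof -
  have "(E *\<^sub>v x, A *\<^sub>v x) \<in> lrel_prod D L"
    unfolding range_eq[symmetric] using assms by (auto simp: stacked_range_def)
  then show ?thesis using that by (auto simp: lrel_prod_def)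
qed

lemma pencil_at_carrier [simp]: "s \<cdot>\<^sub>m E - A \<in> carrier_mat n n"
  using A by (rule minus_carrier_mat)

text \<open>A nonzero polynomial has finitely many roots, so \<open>s\<close> can avoid them. The
  left inverse serves for kernels, the right inverse for ranges.\<close>

lemma regular_inverse:
  obtains s B where "B \<in> carrier_mat n n" "B * (s \<cdot>\<^sub>m E - A) = 1\<^sub>m n" "(s \<cdot>\<^sub>m E - A) * B = 1\<^sub>m n"
proof -
  have "finite {s. poly (det (pencil E A)) s = 0}"
    using regular by (intro poly_roots_finite) (simp add: regular_pencil_def)
  then obtain s where "poly (det (pencil E A)) s \<noteq> 0"
    by (metis (mono_tags, lifting) Collect_cong UNIV_def infinite_UNIV_char_0)
  then have "det (s \<cdot>\<^sub>m E - A) \<noteq> 0" by (simp add: det_pencil_eval[OF E A])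
  then have "s \<cdot>\<^sub>m E - A \<in> Units (ring_mat TYPE(complex) n ())"
    using E A by (intro det_non_zero_imp_unit) auto
  then show ?thesis using that by (auto simp: Units_def ring_mat_def)
qed

lemma pencil_mult_vec:
  "x \<in> carrier_vec n \<Longrightarrow> (s \<cdot>\<^sub>m E - A) *\<^sub>v x = s \<cdot>\<^sub>v (E *\<^sub>v x) - A *\<^sub>v x"
  using E A by (simp add: minus_mult_distrib_mat_vec[of _ n n]) (auto intro!: eq_vecI)

lemma kernel_trivial:
  assumes "x \<in> carrier_vec n" "E *\<^sub>v x = 0\<^sub>v n" "A *\<^sub>v x = 0\<^sub>v n"
  shows "x = 0\<^sub>v n"
proof -
  obtain s B where B: "B \<in> carrier_mat n n" "B * (s \<cdot>\<^sub>m E - A) = 1\<^sub>m n" by (rule regular_inverse)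
  have "x = B *\<^sub>v ((s \<cdot>\<^sub>m E - A) *\<^sub>v x)"
    using assoc_mult_mat_vec[of B n n "s \<cdot>\<^sub>m E - A" n x] B A E assms(1) by simp
  also have "(s \<cdot>\<^sub>m E - A) *\<^sub>v x = 0\<^sub>v n" using assms by (auto simp: pencil_mult_vec)
  also have "B *\<^sub>v 0\<^sub>v n = 0\<^sub>v n" using B by (intro eq_vecI) auto
  finally show ?thesis .
qed

text \<open>By the right inverse, \<open>y = (s E - A) (B y)\<close> is a combination of vectors
  from the two ranges, so \<open>y\<close> is orthogonal to itself. This is how an isotropic link is
  shown to be zero.\<close>

lemma orthogonal_ranges:
  assumes y: "y \<in> carrier_vec n"
    and Ey: "\<And>x. x \<in> carrier_vec n \<Longrightarrow> (E *\<^sub>v x) \<bullet>c y = 0"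
    and Ay: "\<And>x. x \<in> carrier_vec n \<Longrightarrow> (A *\<^sub>v x) \<bullet>c y = 0"
  shows "y = 0\<^sub>v n"
proof -
  obtain s B where B: "B \<in> carrier_mat n n" "(s \<cdot>\<^sub>m E - A) * B = 1\<^sub>m n" by (rule regular_inverse)
  define x where "x = B *\<^sub>v y"
  have x: "x \<in> carrier_vec n" using B y by (auto simp: x_def)
  have "y = (s \<cdot>\<^sub>m E - A) *\<^sub>v x"
    using assoc_mult_mat_vec[of "s \<cdot>\<^sub>m E - A" n n B n y] B A E y by (simp add: x_def)
  also have "\<dots> = s \<cdot>\<^sub>v (E *\<^sub>v x) + (-1) \<cdot>\<^sub>v (A *\<^sub>v x)"
    using E A x by (subst pencil_mult_vec) (auto intro!: eq_vecI)
  finally have "y \<bullet>c y = (s \<cdot>\<^sub>v (E *\<^sub>v x) + (-1) \<cdot>\<^sub>v (A *\<^sub>v x)) \<bullet>c y" by simp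
  also have "\<dots> = 0"
    using E A x y Ey[OF x] Ay[OF x]
    by (subst cinner_add_left[of _ n]) (auto simp: cinner_smult_left[of _ n])
  finally show ?thesis using y by simp
qed

text \<open>
  Both \<open>(z, 0)\<close> and \<open>(0, z)\<close> lie in the product \<open>D L\<close>, so the stacked range contains
  \<open>(E u, 0) = (z, 0)\<close> and \<open>(0, A v) = (0, z)\<close>; then \<open>u + s v\<close> is in the kernel of \<open>s E - A\<close> for all \<open>s\<close>.
\<close>

lemma common_multivalued_part:
  assumes L: "(z, 0\<^sub>v n) \<in> L" and D: "(0\<^sub>v n, z) \<in> D"
  shows "z = 0\<^sub>v n"
proof -
  have "(z, 0\<^sub>v n) \<in> lrel_prod D L" "(0\<^sub>v n, z) \<in> lrel_prod D L"
    using L D zero_mem by (auto simp: lrel_prod_def)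
  then obtain u v where u: "u \<in> carrier_vec n" "E *\<^sub>v u = z" "A *\<^sub>v u = 0\<^sub>v n"
    and v: "v \<in> carrier_vec n" "E *\<^sub>v v = 0\<^sub>v n" "A *\<^sub>v v = z"
    unfolding range_eq[symmetric] by (auto simp: stacked_range_def)
  obtain s B where B: "B \<in> carrier_mat n n" "B * (s \<cdot>\<^sub>m E - A) = 1\<^sub>m n" by (rule regular_inverse)
  have uv: "u + s \<cdot>\<^sub>v v \<in> carrier_vec n" using u v by simp
  have Euv: "E *\<^sub>v (u + s \<cdot>\<^sub>v v) = z"
    using E u v L_carrier[OF L] by (simp add: mult_add_distrib_mat_vec[of _ n n] mult_mat_vec)
  have Auv: "A *\<^sub>v (u + s \<cdot>\<^sub>v v) = s \<cdot>\<^sub>v z"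
    using A u v L_carrier[OF L] by (simp add: mult_add_distrib_mat_vec[of _ n n] mult_mat_vec)
  have "u + s \<cdot>\<^sub>v v = B *\<^sub>v ((s \<cdot>\<^sub>m E - A) *\<^sub>v (u + s \<cdot>\<^sub>v v))"
    using assoc_mult_mat_vec[of B n n "s \<cdot>\<^sub>m E - A" n "u + s \<cdot>\<^sub>v v"] B A E uv by simp
  also have "(s \<cdot>\<^sub>m E - A) *\<^sub>v (u + s \<cdot>\<^sub>v v) = 0\<^sub>v n"
    using L_carrier[OF L] by (simp add: pencil_mult_vec[OF uv] Euv Auv)
  also have "B *\<^sub>v 0\<^sub>v n = 0\<^sub>v n" using B by (intro eq_vecI) auto
  finally have "z = E *\<^sub>v 0\<^sub>v n" using Euv by simp
  also have "\<dots> = 0\<^sub>v n" using E by (intro eq_vecI) auto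
  finally show ?thesis .
qed

section \<open>Nonzero finite eigenvalues\<close>

text \<open>If the form vanished, \<open>(E x, y)\<close> would be isotropic in \<open>L\<close>
  and, as \<open>A x\<close> is a multiple of \<open>E x\<close>, \<open>(y, A x)\<close> isotropic
  in \<open>D\<close>. Then \<open>y\<close> is orthogonal to both ranges, so \<open>y = 0\<close>,
  and \<open>z = E x\<close> lies in the common multivalued part.\<close>

lemma eigenvector_link_pos:
  assumes x: "x \<in> carrier_vec n" and ev: "A *\<^sub>v x = \<mu> \<cdot>\<^sub>v (E *\<^sub>v x)" and mu: "\<mu> \<noteq> 0"
    and x0: "x \<noteq> 0\<^sub>v n" and L: "(E *\<^sub>v x, y) \<in> L" and D: "(y, A *\<^sub>v x) \<in> D"
  shows "y \<bullet>c (E *\<^sub>v x) \<noteq> 0"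
proof
  assume 0: "y \<bullet>c (E *\<^sub>v x) = 0"
  note y = L_carrier(2)[OF L]
  have Ex: "E *\<^sub>v x \<in> carrier_vec n" using E x by simp
  have yA: "y \<bullet>c (A *\<^sub>v x) = 0" using 0 y Ex by (simp add: ev cinner_smult_right[of _ n])
  have perp: "v \<bullet>c y = 0" if "(v, w) \<in> L" for v w
    using isotropic_L[OF L _ that] 0 cnj_cinner[OF Ex y] by (metis complex_cnj_zero_iff)
  have "y = 0\<^sub>v n"
  proof (rule orthogonal_ranges[OF y])
    fix x' :: "complex vec" assume x': "x' \<in> carrier_vec n"
    then obtain y' where y': "(E *\<^sub>v x', y') \<in> L" "(y', A *\<^sub>v x') \<in> D" by (rule linkE)
    show "(E *\<^sub>v x') \<bullet>c y = 0" using perp y'(1) .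
    \<comment> \<open>Symmetry of \<open>L\<close> turns the orthogonality of \<open>y\<close> to
      \<open>E x'\<close> into that of \<open>y'\<close> to \<open>E x\<close>, hence to
      \<open>A x\<close>; \<open>isotropic_D\<close> carries it on to \<open>y\<close> and
      \<open>A x'\<close>.\<close>
    have "y' \<bullet>c (E *\<^sub>v x) = 0" using L_sym[OF L y'(1)] perp[OF y'(1)] by simp
    then have "y' \<bullet>c (A *\<^sub>v x) = 0"
      using L_carrier(2)[OF y'(1)] Ex by (simp add: ev cinner_smult_right[of _ n])
    then have "y \<bullet>c (A *\<^sub>v x') = 0" using isotropic_D[OF D _ y'(2)] yA by simp
    then show "(A *\<^sub>v x') \<bullet>c y = 0"
      using cnj_cinner[OF y D_carrier(2)[OF y'(2)]] by simp
  qed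
  \<comment> \<open>The pair \<open>(0, A x)\<close> is scaled by \<open>1 / \<mu>\<close>, written
    as adding a multiple of it to the zero pair.\<close>
  then have "(0\<^sub>v n, E *\<^sub>v x) \<in> D"
    using D_combine[OF zero_mem(1) D, of "1 / \<mu>"] mu Ex by (simp add: ev smult_smult_assoc)
  then have "E *\<^sub>v x = 0\<^sub>v n" using common_multivalued_part L \<open>y = 0\<^sub>v n\<close> by simp
  then show False using kernel_trivial[OF x] ev x0 by simp
qed

text \<open>For an eigenvector, \<open>Re (y \<bullet>c (A x))\<close> is \<open>Re \<mu>\<close>
  times \<open>y \<bullet>c (E x)\<close>. The latter is positive for
  \<open>\<mu> \<noteq> 0\<close>, and dissipativity makes the product nonpositive.\<close>

lemma eigenvalue_Re_le:
  assumes "\<mu> \<in> pencil_eigenvalues E A"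
  shows "Re \<mu> \<le> 0"
proof (cases "\<mu> = 0")
  case False
  from assms obtain x where x: "x \<in> carrier_vec n" "x \<noteq> 0\<^sub>v n" "(\<mu> \<cdot>\<^sub>m E - A) *\<^sub>v x = 0\<^sub>v n"
    using det_0_iff_vec_prod_zero[of "\<mu> \<cdot>\<^sub>m E - A" n] E A by (auto simp: pencil_eigenvalues_def)
  have ev: "A *\<^sub>v x = \<mu> \<cdot>\<^sub>v (E *\<^sub>v x)"
  proof (rule eq_vecI)
    fix i assume "i < dim_vec (\<mu> \<cdot>\<^sub>v (E *\<^sub>v x))"
    then show "(A *\<^sub>v x) $ i = (\<mu> \<cdot>\<^sub>v (E *\<^sub>v x)) $ i"
      using arg_cong[OF x(3), of "\<lambda>v. v $ i"] E A x(1)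
      by (simp add: pencil_mult_vec del: index_mult_mat_vec) 
  qed (use E A in simp)
  obtain y where y: "(E *\<^sub>v x, y) \<in> L" "(y, A *\<^sub>v x) \<in> D" using x(1) by (rule linkE)
  have Ex: "E *\<^sub>v x \<in> carrier_vec n" using E x by simp
  have ge: "0 \<le> y \<bullet>c (E *\<^sub>v x)"
    using L_ge[OF y(1)] L_sym[OF y(1) y(1)] by simp
  moreover have "y \<bullet>c (E *\<^sub>v x) \<noteq> 0" by (rule eigenvector_link_pos[OF x(1) ev False x(2) y])
  ultimately have q: "0 < Re (y \<bullet>c (E *\<^sub>v x))" "Im (y \<bullet>c (E *\<^sub>v x)) = 0"
    by (auto simp: less_eq_complex_def complex_eq_iff)
  have "Re (y \<bullet>c (A *\<^sub>v x)) \<le> 0" by (rule D_le[OF y(2)])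
  then have "Re \<mu> * Re (y \<bullet>c (E *\<^sub>v x)) \<le> 0"
    using L_carrier(2)[OF y(1)] Ex q by (simp add: ev cinner_smult_right[of _ n])
  then show ?thesis using q by (simp add: mult_le_0_iff)
qed simp

text \<open>On the imaginary axis \<open>(y0, A x0)\<close> is isotropic in \<open>D\<close>, since
  \<open>y0 \<bullet>c (E x0)\<close> is real. In the relation of \<open>isotropic_D\<close> with
  \<open>(y1, A x1)\<close> the terms containing \<open>\<mu>\<close> cancel by symmetry of
  \<open>L\<close> and \<open>cnj \<mu> = - \<mu>\<close>; what is left is
  \<open>y0 \<bullet>c (E x0) = 0\<close>, against \<open>eigenvector_link_pos\<close>.\<close>

lemma imaginary_no_chain:
  assumes x0: "x0 \<in> carrier_vec n" "x0 \<noteq> 0\<^sub>v n" "A *\<^sub>v x0 = \<mu> \<cdot>\<^sub>v (E *\<^sub>v x0)"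
    and x1: "x1 \<in> carrier_vec n" "A *\<^sub>v x1 = \<mu> \<cdot>\<^sub>v (E *\<^sub>v x1) + E *\<^sub>v x0"
    and mu: "\<mu> \<noteq> 0" "Re \<mu> = 0"
  shows False
proof -
  obtain y0 where y0: "(E *\<^sub>v x0, y0) \<in> L" "(y0, A *\<^sub>v x0) \<in> D" using x0(1) by (rule linkE)
  obtain y1 where y1: "(E *\<^sub>v x1, y1) \<in> L" "(y1, A *\<^sub>v x1) \<in> D" using x1(1) by (rule linkE)
  have Ex: "E *\<^sub>v x0 \<in> carrier_vec n" "E *\<^sub>v x1 \<in> carrier_vec n" using E x0 x1 by simp_all
  note c = L_carrier(2)[OF y0(1)] L_carrier(2)[OF y1(1)]
  have "0 \<le> y0 \<bullet>c (E *\<^sub>v x0)" using L_ge[OF y0(1)] L_sym[OF y0(1) y0(1)] by simp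
  then have "Im (y0 \<bullet>c (E *\<^sub>v x0)) = 0" by (simp add: less_eq_complex_def)
  then have "Re (y0 \<bullet>c (A *\<^sub>v x0)) = 0"
    using c Ex mu by (simp add: x0 cinner_smult_right[of _ n])
  from isotropic_D[OF y0(2) this y1(2)]
  have "cnj \<mu> * (y1 \<bullet>c (E *\<^sub>v x0)) = - cnj (cnj \<mu> * (y0 \<bullet>c (E *\<^sub>v x1)) + y0 \<bullet>c (E *\<^sub>v x0))"
    using c Ex by (simp add: x0 x1 cinner_smult_right[of _ n] cinner_add_right[of _ n])
  moreover have "cnj (y0 \<bullet>c (E *\<^sub>v x1)) = y1 \<bullet>c (E *\<^sub>v x0)"
    using L_sym[OF y0(1) y1(1)] cnj_cinner[OF c(1) Ex(2)] by simp
  moreover have "cnj \<mu> = - \<mu>" using mu by (simp add: complex_eq_iff)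
  ultimately have "cnj (y0 \<bullet>c (E *\<^sub>v x0)) = 0" by (simp add: algebra_simps)
  then show False using eigenvector_link_pos[OF x0(1,3) mu(1) x0(2) y0] by simp
qed

section \<open>Chains at zero and at infinity\<close>

text \<open>The links \<open>y0\<close> and \<open>y1\<close> are shown to vanish in turn, which
  puts \<open>z = E x0\<close> into the common multivalued part. For \<open>y0\<close>, the pair
  \<open>(y0, 0)\<close> is isotropic in \<open>D\<close>, so \<open>y0\<close> is orthogonal to
  every second component of \<open>D\<close>, including \<open>A x1 = E x0\<close>.\<close>

lemma kernel_A_no_long_chain:
  assumes x0: "x0 \<in> carrier_vec n" "x0 \<noteq> 0\<^sub>v n" "A *\<^sub>v x0 = 0\<^sub>v n"
    and x1: "x1 \<in> carrier_vec n" "A *\<^sub>v x1 = E *\<^sub>v x0"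
    and x2: "x2 \<in> carrier_vec n" "A *\<^sub>v x2 = E *\<^sub>v x1"
  shows False
proof -
  obtain y0 where y0: "(E *\<^sub>v x0, y0) \<in> L" "(y0, 0\<^sub>v n) \<in> D" using x0 linkE by metis
  obtain y1 where y1: "(E *\<^sub>v x1, y1) \<in> L" "(y1, E *\<^sub>v x0) \<in> D" using x1 linkE by metis
  obtain y2 where y2: "(E *\<^sub>v x2, y2) \<in> L" "(y2, E *\<^sub>v x1) \<in> D" using x2 linkE by metis
  note c = L_carrier[OF y0(1)] L_carrier[OF y1(1)] L_carrier[OF y2(1)]
  have y0_perp: "w \<bullet>c y0 = 0" if "(v, w) \<in> D" for v w
    using isotropic_D[OF y0(2) _ that] D_carrier[OF that] c cnj_cinner[of w n y0] by simp
  have "(E *\<^sub>v x0) \<bullet>c y0 = 0" using y0_perp y1(2) .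
  then have perp0: "v \<bullet>c y0 = 0" if "(v, w) \<in> L" for v w
    using isotropic_L[OF y0(1)] that by simp
  have "y0 = 0\<^sub>v n"
  proof (rule orthogonal_ranges)
    fix x :: "complex vec" assume "x \<in> carrier_vec n"
    then obtain y where "(E *\<^sub>v x, y) \<in> L" "(y, A *\<^sub>v x) \<in> D" by (rule linkE)
    then show "(E *\<^sub>v x) \<bullet>c y0 = 0" "(A *\<^sub>v x) \<bullet>c y0 = 0"
      using perp0 y0_perp by blast+
  qed (rule c)
  \<comment> \<open>Now \<open>E x0\<close> is orthogonal to every second component of
    \<open>L\<close>, hence to all links. This makes \<open>(y1, E x0)\<close> isotropic in
    \<open>D\<close>, and the link \<open>y2\<close> then gives isotropy of
    \<open>(E x1, y1)\<close> in \<open>L\<close>.\<close>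
  have L0: "w \<bullet>c (E *\<^sub>v x0) = 0" if "(v, w) \<in> L" for v w
    using L_sym[OF y0(1) that] perp0[OF that] by simp
  note iso1 = isotropic_D[OF y1(2)]
  have "y1 \<bullet>c (E *\<^sub>v x1) = 0"
    using iso1[OF _ y2(2)] L0[OF y1(1)] L0[OF y2(1)] by simp
  then have "(E *\<^sub>v x1) \<bullet>c y1 = 0" using cnj_cinner[OF c(4,3)] by simp
  note perp1 = isotropic_L[OF y1(1) this]
  have "y1 = 0\<^sub>v n"
  proof (rule orthogonal_ranges)
    fix x :: "complex vec" assume "x \<in> carrier_vec n"
    then obtain y where y: "(E *\<^sub>v x, y) \<in> L" "(y, A *\<^sub>v x) \<in> D" by (rule linkE)
    show "(E *\<^sub>v x) \<bullet>c y1 = 0" using perp1 y(1) .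
    have "y1 \<bullet>c (A *\<^sub>v x) = 0" using iso1[OF _ y(2)] L0[OF y1(1)] L0[OF y(1)] by simp
    then show "(A *\<^sub>v x) \<bullet>c y1 = 0" using cnj_cinner[OF c(4) D_carrier(2)[OF y(2)]] by simp
  qed (rule c)
  then have "E *\<^sub>v x0 = 0\<^sub>v n"
    using common_multivalued_part y0(1) y1(2) \<open>y0 = 0\<^sub>v n\<close> by simp
  then show False using kernel_trivial x0 by blast
qed

text \<open>Isotropy climbs the chain, starting from \<open>(0, y0)\<close> in \<open>L\<close>. If
  the pair of \<open>y0\<close> or \<open>y1\<close> in \<open>L\<close> is isotropic, that link is
  orthogonal to all first components of \<open>L\<close>, among them the next two vectors
  \<open>A xj = E x(j+1)\<close>: the nearer one gives isotropy of its pair in \<open>D\<close>, the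
  farther one isotropy of the next link's pair in \<open>L\<close>. Reaching \<open>y2\<close> takes
  \<open>x3\<close>.\<close>

lemma infinite_no_long_chain:
  assumes x0: "x0 \<in> carrier_vec n" "x0 \<noteq> 0\<^sub>v n" "E *\<^sub>v x0 = 0\<^sub>v n"
    and x1: "x1 \<in> carrier_vec n" "E *\<^sub>v x1 = A *\<^sub>v x0"
    and x2: "x2 \<in> carrier_vec n" "E *\<^sub>v x2 = A *\<^sub>v x1"
    and x3: "x3 \<in> carrier_vec n" "E *\<^sub>v x3 = A *\<^sub>v x2"
  shows False
proof -
  obtain y0 where y0: "(0\<^sub>v n, y0) \<in> L" "(y0, A *\<^sub>v x0) \<in> D" using x0 linkE by metis
  obtain y1 where y1: "(A *\<^sub>v x0, y1) \<in> L" "(y1, A *\<^sub>v x1) \<in> D" using x1 linkE by metis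
  obtain y2 where y2: "(A *\<^sub>v x1, y2) \<in> L" "(y2, A *\<^sub>v x2) \<in> D" using x2 linkE by metis
  obtain y3 where y3: "(A *\<^sub>v x2, y3) \<in> L" "(y3, A *\<^sub>v x3) \<in> D" using x3 linkE by metis
  note c = L_carrier[OF y0(1)] L_carrier[OF y1(1)] L_carrier[OF y2(1)] L_carrier[OF y3(1)]
  have sw: "a \<bullet>c b = 0" if "b \<bullet>c a = 0" "a \<in> carrier_vec n" "b \<in> carrier_vec n" for a b :: "complex vec"
    using cnj_cinner[OF that(3,2)] that(1) by simp
  have perp0: "v \<bullet>c y0 = 0" if "(v, w) \<in> L" for v w
    using isotropic_L[OF y0(1) _ that] c by simp
  have "y0 \<bullet>c (A *\<^sub>v x0) = 0" using perp0[OF y1(1)] sw c by blast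
  then have iso0: "v \<bullet>c (A *\<^sub>v x0) = - cnj (y0 \<bullet>c w)" if "(v, w) \<in> D" for v w
    using isotropic_D[OF y0(2) _ that] by simp
  have "y0 \<bullet>c (A *\<^sub>v x1) = 0" using perp0[OF y2(1)] sw c by blast
  then have "y1 \<bullet>c (A *\<^sub>v x0) = 0" using iso0[OF y1(2)] by simp
  then have "(A *\<^sub>v x0) \<bullet>c y1 = 0" using sw c by blast
  then have perp1: "v \<bullet>c y1 = 0" if "(v, w) \<in> L" for v w
    using isotropic_L[OF y1(1) _ that] by simp
  have "y1 \<bullet>c (A *\<^sub>v x1) = 0" using perp1[OF y2(1)] sw c by blast
  then have iso1: "v \<bullet>c (A *\<^sub>v x1) = - cnj (y1 \<bullet>c w)" if "(v, w) \<in> D" for v w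
    using isotropic_D[OF y1(2) _ that] by simp
  have "y1 \<bullet>c (A *\<^sub>v x2) = 0" using perp1[OF y3(1)] sw c by blast
  then have "y2 \<bullet>c (A *\<^sub>v x1) = 0" using iso1[OF y2(2)] by simp
  then have "(A *\<^sub>v x1) \<bullet>c y2 = 0" using sw c by blast
  then have perp2: "v \<bullet>c y2 = 0" if "(v, w) \<in> L" for v w
    using isotropic_L[OF y2(1) _ that] by simp
  \<comment> \<open>Orthogonality to the range of \<open>A\<close> is passed down from the next
    link: \<open>perp2\<close> and symmetry control \<open>y \<bullet>c (A x1)\<close>, and
    \<open>iso1\<close> converts this. The same holds for \<open>y0\<close> with
    \<open>perp1\<close> and \<open>iso0\<close>.\<close>
  have y1_0: "y1 = 0\<^sub>v n"
  proof (rule orthogonal_ranges)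
    fix x :: "complex vec" assume "x \<in> carrier_vec n"
    then obtain y where y: "(E *\<^sub>v x, y) \<in> L" "(y, A *\<^sub>v x) \<in> D" by (rule linkE)
    show "(E *\<^sub>v x) \<bullet>c y1 = 0" using perp1 y(1) .
    have "y \<bullet>c (A *\<^sub>v x1) = 0" using L_sym[OF y2(1) y(1)] perp2[OF y(1)] by simp
    then have "y1 \<bullet>c (A *\<^sub>v x) = 0" using iso1[OF y(2)] by simp
    then show "(A *\<^sub>v x) \<bullet>c y1 = 0" using sw c D_carrier(2)[OF y(2)] by blast
  qed (rule c)
  have "y0 = 0\<^sub>v n"
  proof (rule orthogonal_ranges)
    fix x :: "complex vec" assume "x \<in> carrier_vec n"
    then obtain y where y: "(E *\<^sub>v x, y) \<in> L" "(y, A *\<^sub>v x) \<in> D" by (rule linkE)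
    show "(E *\<^sub>v x) \<bullet>c y0 = 0" using perp0 y(1) .
    have "y \<bullet>c (A *\<^sub>v x0) = 0" using L_sym[OF y1(1) y(1)] perp1[OF y(1)] by simp
    then have "y0 \<bullet>c (A *\<^sub>v x) = 0" using iso0[OF y(2)] by simp
    then show "(A *\<^sub>v x) \<bullet>c y0 = 0" using sw c D_carrier(2)[OF y(2)] by blast
  qed (rule c)
  then have "A *\<^sub>v x0 = 0\<^sub>v n" using common_multivalued_part y1(1) y0(2) y1_0 by simp
  then show False using kernel_trivial x0 by blast
qed

section \<open>Shorter chains when \<open>L\<close> is definite\<close>

text \<open>As \<open>(y0, 0)\<close> is isotropic in \<open>D\<close>, the link \<open>y0\<close>
  is orthogonal to \<open>A x1 = E x0\<close>; definiteness turns this at once into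
  \<open>E x0 = 0\<close>.\<close>

lemma definite_kernel_A_no_chain:
  assumes definite: "\<forall>(z, y)\<in>L. z \<bullet>c y = 0 \<longrightarrow> z = 0\<^sub>v n"
    and x0: "x0 \<in> carrier_vec n" "x0 \<noteq> 0\<^sub>v n" "A *\<^sub>v x0 = 0\<^sub>v n"
    and x1: "x1 \<in> carrier_vec n" "A *\<^sub>v x1 = E *\<^sub>v x0"
  shows False
proof -
  obtain y0 where y0: "(E *\<^sub>v x0, y0) \<in> L" "(y0, 0\<^sub>v n) \<in> D" using x0 linkE by metis
  obtain y1 where y1: "(y1, E *\<^sub>v x0) \<in> D" using x1 linkE by metis
  note c = L_carrier[OF y0(1)]
  have "y0 \<bullet>c (E *\<^sub>v x0) = 0"
    using isotropic_D[OF y0(2) _ y1] D_carrier[OF y1] c by simp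
  then have "E *\<^sub>v x0 = 0\<^sub>v n" using definite y0(1) cnj_cinner[OF c(2,1)] by auto
  then show False using kernel_trivial x0 by blast
qed

text \<open>\<open>inj\<close> gives \<open>y0 = 0\<close>, so \<open>(0, A x0)\<close> is isotropic
  in \<open>D\<close> and \<open>A x0\<close> is orthogonal to \<open>y1\<close>; definiteness
  applied to \<open>(A x0, y1)\<close> yields \<open>A x0 = 0\<close>.\<close>

lemma definite_infinite_no_chain:
  assumes definite: "\<forall>(z, y)\<in>L. z \<bullet>c y = 0 \<longrightarrow> z = 0\<^sub>v n"
    and inj: "\<forall>y. (0\<^sub>v n, y) \<in> L \<longrightarrow> y = 0\<^sub>v n"
    and x0: "x0 \<in> carrier_vec n" "x0 \<noteq> 0\<^sub>v n" "E *\<^sub>v x0 = 0\<^sub>v n"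
    and x1: "x1 \<in> carrier_vec n" "E *\<^sub>v x1 = A *\<^sub>v x0"
  shows False
proof -
  obtain y0 where y0: "(0\<^sub>v n, y0) \<in> L" "(y0, A *\<^sub>v x0) \<in> D" using x0 linkE by metis
  obtain y1 where y1: "(A *\<^sub>v x0, y1) \<in> L" "(y1, A *\<^sub>v x1) \<in> D" using x1 linkE by metis
  note c = L_carrier[OF y1(1)]
  have "y0 = 0\<^sub>v n" using inj y0(1) by simp
  then have "y1 \<bullet>c (A *\<^sub>v x0) = 0"
    using isotropic_D[OF y0(2) _ y1(2)] D_carrier[OF y1(2)] c by simp
  then have "A *\<^sub>v x0 = 0\<^sub>v n" using definite y1(1) cnj_cinner[OF c(2,1)] by auto
  then show False using kernel_trivial x0 by blast
qed

section \<open>From excluded chains to bounds on block sizes\<close>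

lemma semi_simple_imaginary:
  assumes "\<mu> \<noteq> 0" "Re \<mu> = 0"
  shows "semi_simple n E A \<mu>"
  unfolding semi_simple_def
proof clarify
  fix k :: nat assume k: "2 \<le> k" and j: "jordan_block_at n E A \<mu> k"
  obtain x where x: "\<forall>j<k. x j \<in> carrier_vec n" "x 0 \<noteq> 0\<^sub>v n"
    "A *\<^sub>v x 0 = \<mu> \<cdot>\<^sub>v (E *\<^sub>v x 0)"
    "\<forall>j. Suc j < k \<longrightarrow> A *\<^sub>v x (Suc j) = \<mu> \<cdot>\<^sub>v (E *\<^sub>v x (Suc j)) + E *\<^sub>v x j"
    by (rule jordan_chain[OF j E A])
  show False
    by (rule imaginary_no_chain[of "x 0" \<mu> "x 1"]) (use x k assms x(4)[rule_format, of 0] in auto)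
qed

lemma jordan_chain_zero:
  assumes "jordan_block_at n E A 0 k"
  obtains x where "\<forall>j<k. x j \<in> carrier_vec n" "x 0 \<noteq> 0\<^sub>v n"
    "A *\<^sub>v x 0 = 0\<^sub>v n" "\<forall>j. Suc j < k \<longrightarrow> A *\<^sub>v x (Suc j) = E *\<^sub>v x j"
proof (rule jordan_chain[OF assms E A])
  fix x assume x: "\<forall>j<k. x j \<in> carrier_vec n" "x 0 \<noteq> 0\<^sub>v n"
    "A *\<^sub>v x 0 = 0 \<cdot>\<^sub>v (E *\<^sub>v x 0)"
    "\<forall>j. Suc j < k \<longrightarrow> A *\<^sub>v x (Suc j) = 0 \<cdot>\<^sub>v (E *\<^sub>v x (Suc j)) + E *\<^sub>v x j"
  have z: "0 \<cdot>\<^sub>v (E *\<^sub>v x j) = 0\<^sub>v n" for j using E by (intro eq_vecI) auto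
  have c: "E *\<^sub>v x j \<in> carrier_vec n" for j using E by (intro carrier_vecI) simp
  have "A *\<^sub>v x (Suc j) = E *\<^sub>v x j" if "Suc j < k" for j
    using x(4) that left_zero_vec[OF c] by (simp only: z)
  moreover have "A *\<^sub>v x 0 = 0\<^sub>v n" using x(3) by (simp only: z)
  ultimately show thesis by (intro that[OF x(1,2)]) blast+
qed

lemma block_at_zero_le:
  assumes "jordan_block_at n E A 0 k"
  shows "k \<le> 2"
proof (rule ccontr)
  assume k: "\<not> k \<le> 2"
  obtain x where x: "\<forall>j<k. x j \<in> carrier_vec n" "x 0 \<noteq> 0\<^sub>v n"
    "A *\<^sub>v x 0 = 0\<^sub>v n" "\<forall>j. Suc j < k \<longrightarrow> A *\<^sub>v x (Suc j) = E *\<^sub>v x j"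
    by (rule jordan_chain_zero[OF assms])
  show False
    by (rule kernel_A_no_long_chain[of "x 0" "x 1" "x 2"])
      (use x k x(4)[rule_format, of 0] x(4)[rule_format, of 1] in \<open>auto simp: numeral_2_eq_2\<close>)
qed

lemma block_at_infinity_le:
  assumes "jordan_block_at_infinity n E A k"
  shows "k \<le> 3"
proof (rule ccontr)
  assume k: "\<not> k \<le> 3"
  obtain x where x: "\<forall>j<k. x j \<in> carrier_vec n" "x 0 \<noteq> 0\<^sub>v n"
    "E *\<^sub>v x 0 = 0\<^sub>v n" "\<forall>j. Suc j < k \<longrightarrow> E *\<^sub>v x (Suc j) = A *\<^sub>v x j"
    by (rule jordan_chain_at_infinity[OF assms E A])
  show False
    by (rule infinite_no_long_chain[of "x 0" "x 1" "x 2" "x 3"])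
      (use x k x(4)[rule_format, of 0] x(4)[rule_format, of 1] x(4)[rule_format, of 2] in \<open>auto simp: numeral_2_eq_2 numeral_3_eq_3\<close>)
qed

lemma definite_semi_simple_zero:
  assumes "\<forall>(z, y)\<in>L. z \<bullet>c y = 0 \<longrightarrow> z = 0\<^sub>v n"
  shows "semi_simple n E A 0"
  unfolding semi_simple_def
proof clarify
  fix k :: nat assume k: "2 \<le> k" and j: "jordan_block_at n E A 0 k"
  obtain x where x: "\<forall>j<k. x j \<in> carrier_vec n" "x 0 \<noteq> 0\<^sub>v n"
    "A *\<^sub>v x 0 = 0\<^sub>v n" "\<forall>j. Suc j < k \<longrightarrow> A *\<^sub>v x (Suc j) = E *\<^sub>v x j"
    by (rule jordan_chain_zero[OF j])
  show False
    by (rule definite_kernel_A_no_chain[OF assms, of "x 0" "x 1"]) (use x k x(4)[rule_format, of 0] in auto)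
qed

lemma definite_block_at_infinity_le:
  assumes "\<forall>(z, y)\<in>L. z \<bullet>c y = 0 \<longrightarrow> z = 0\<^sub>v n"
    and "\<forall>y. (0\<^sub>v n, y) \<in> L \<longrightarrow> y = 0\<^sub>v n"
    and J: "jordan_block_at_infinity n E A k"
  shows "k \<le> 1"
proof (rule ccontr)
  assume k: "\<not> k \<le> 1"
  obtain x where x: "\<forall>j<k. x j \<in> carrier_vec n" "x 0 \<noteq> 0\<^sub>v n"
    "E *\<^sub>v x 0 = 0\<^sub>v n" "\<forall>j. Suc j < k \<longrightarrow> E *\<^sub>v x (Suc j) = A *\<^sub>v x j"
    by (rule jordan_chain_at_infinity[OF J E A])
  show False
    by (rule definite_infinite_no_chain[OF assms(1,2), of "x 0" "x 1"]) (use x k x(4)[rule_format, of 0] in auto)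
qed

end

text \<open>\<open>Max\<close> needs a finite set, and the bound on the block sizes itself provides
  finiteness.\<close>

lemma pencil_index_le:
  assumes "\<And>k. jordan_block_at_infinity n E A k \<Longrightarrow> k \<le> m"
  shows "pencil_index n E A \<le> m"
proof -
  have "finite {k. jordan_block_at_infinity n E A k}"
    by (rule finite_subset[of _ "{..m}"]) (use assms in auto)
  then show ?thesis unfolding pencil_index_def using assms by simp
qed


section \<open>Complexification of real relations\<close>

text \<open>For a real linear relation this is its complex span \<open>M + \<i> M\<close>, formed
  inside the same type.\<close>

definition complexify :: "lrel \<Rightarrow> lrel" where
  "complexify M = {(x + \<i> \<cdot>\<^sub>v v, y + \<i> \<cdot>\<^sub>v w) | x y v w. (x, y) \<in> M \<and> (v, w) \<in> M}"

lemma complexifyI: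
  "(x, y) \<in> M \<Longrightarrow> (v, w) \<in> M \<Longrightarrow> (x + \<i> \<cdot>\<^sub>v v, y + \<i> \<cdot>\<^sub>v w) \<in> complexify M"
  by (auto simp: complexify_def)

lemma Kvec_carrier: "x \<in> Kvec K n \<Longrightarrow> x \<in> carrier_vec n"
  by (simp add: Kvec_def)

lemma Kvec_Real_index: "x \<in> Kvec \<real> n \<Longrightarrow> i < n \<Longrightarrow> Im (x $ i) = 0"
  by (auto simp: Kvec_def complex_is_Real_iff)

lemma real_decomposition:
  assumes "v \<in> carrier_vec n"
  obtains x y where "x \<in> Kvec \<real> n" "y \<in> Kvec \<real> n" "v = x + \<i> \<cdot>\<^sub>v y"
proof (rule that)
  show "vec n (\<lambda>i. of_real (Re (v $ i))) \<in> Kvec \<real> n" "vec n (\<lambda>i. of_real (Im (v $ i))) \<in> Kvec \<real> n"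
    by (auto simp: Kvec_def)
  show "v = vec n (\<lambda>i. of_real (Re (v $ i))) + \<i> \<cdot>\<^sub>v vec n (\<lambda>i. of_real (Im (v $ i)))"
    using assms by (intro eq_vecI) (auto simp: complex_eq_iff)
qed

lemma real_decomposition_unique:
  assumes "x \<in> Kvec \<real> n" "y \<in> Kvec \<real> n" "v \<in> Kvec \<real> n" "w \<in> Kvec \<real> n"
    and eq: "x + \<i> \<cdot>\<^sub>v y = v + \<i> \<cdot>\<^sub>v w"
  shows "x = v" "y = w"
proof -
  note c = assms(1-4)[THEN Kvec_carrier]
  note r = assms(1-4)[THEN Kvec_Real_index]
  have "x $ i = v $ i \<and> y $ i = w $ i" if "i < n" for i
    using arg_cong[OF eq, of "\<lambda>u. u $ i"] c r that by (simp add: complex_eq_iff)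
  then show "x = v" "y = w" using c by (auto intro!: eq_vecI)
qed

lemma real_cinner:
  assumes "x \<in> Kvec \<real> n" "y \<in> Kvec \<real> n"
  shows "Im (x \<bullet>c y) = 0" "x \<bullet>c y = y \<bullet>c x"
proof -
  show "Im (x \<bullet>c y) = 0"
    using Kvec_carrier[OF assms(1)] Kvec_carrier[OF assms(2)]
    by (auto simp: scalar_prod_def Kvec_Real_index[OF assms(1)] Kvec_Real_index[OF assms(2)])
  then have "cnj (x \<bullet>c y) = x \<bullet>c y" by (simp add: complex_eq_iff)
  then show "x \<bullet>c y = y \<bullet>c x"
    using cnj_cinner[OF Kvec_carrier[OF assms(1)] Kvec_carrier[OF assms(2)]] by simp
qed

text \<open>For real vectors the bracket is the imaginary part of the form: it does not affect
  dissipativity, and on the diagonal symmetry of the relation makes it vanish.\<close>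

lemma cinner_complex_parts:
  fixes x y v w :: "complex vec"
  assumes "x \<in> carrier_vec n" "v \<in> carrier_vec n" "y \<in> carrier_vec n" "w \<in> carrier_vec n"
  shows "(x + \<i> \<cdot>\<^sub>v v) \<bullet>c (y + \<i> \<cdot>\<^sub>v w) = x \<bullet>c y + v \<bullet>c w + \<i> * (v \<bullet>c y - x \<bullet>c w)"
  using assms by (simp add: cinner_add_left[of _ n] cinner_add_right[of _ n]
      cinner_smult_left[of _ n] cinner_smult_right[of _ n] algebra_simps)

lemma mult_mat_vec_complex_parts:
  fixes M :: "complex mat"
  assumes "M \<in> carrier_mat n n" "x \<in> carrier_vec n" "y \<in> carrier_vec n"
  shows "M *\<^sub>v (x + \<i> \<cdot>\<^sub>v y) = M *\<^sub>v x + \<i> \<cdot>\<^sub>v (M *\<^sub>v y)"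
  using assms by (simp add: mult_add_distrib_mat_vec[of _ n n] mult_mat_vec)

lemma linear_relation_complexify:
  assumes "linear_relation \<real> n M"
  shows "linear_relation UNIV n (complexify M)"
proof -
  note add = linear_relationD(3)[OF assms] and zero = linear_relationD(2)[OF assms]
  have car: "x \<in> carrier_vec n" "y \<in> carrier_vec n" if "(x, y) \<in> M" for x y
    using linear_relation_Kvec[OF assms that] by (auto dest: Kvec_carrier)
  have comb: "(complex_of_real a \<cdot>\<^sub>v x + complex_of_real b \<cdot>\<^sub>v v, complex_of_real a \<cdot>\<^sub>v y + complex_of_real b \<cdot>\<^sub>v w) \<in> M"
    if "(x, y) \<in> M" "(v, w) \<in> M" for x y v w a b
    by (intro add linear_relationD(4)[OF assms] Reals_of_real that)
  show ?thesis
    unfolding linear_relation_def Kvec_UNIV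
  proof (intro conjI allI ballI impI)
    show "complexify M \<subseteq> carrier_vec n \<times> carrier_vec n"
      using car by (auto simp: complexify_def)
    have "(0\<^sub>v n + \<i> \<cdot>\<^sub>v 0\<^sub>v n, 0\<^sub>v n + \<i> \<cdot>\<^sub>v 0\<^sub>v n) \<in> complexify M"
      using zero zero by (rule complexifyI)
    then show "(0\<^sub>v n, 0\<^sub>v n) \<in> complexify M" by simp
  next
    fix p q r s assume "(p, q) \<in> complexify M" "(r, s) \<in> complexify M"
    then obtain x y v w x' y' v' w' where pq: "(x, y) \<in> M" "(v, w) \<in> M" "(x', y') \<in> M" "(v', w') \<in> M"
      and e: "p = x + \<i> \<cdot>\<^sub>v v" "q = y + \<i> \<cdot>\<^sub>v w" "r = x' + \<i> \<cdot>\<^sub>v v'" "s = y' + \<i> \<cdot>\<^sub>v w'"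
      by (auto simp: complexify_def)
    have "((x + x') + \<i> \<cdot>\<^sub>v (v + v'), (y + y') + \<i> \<cdot>\<^sub>v (w + w')) \<in> complexify M"
      using add[OF pq(1,3)] add[OF pq(2,4)] by (rule complexifyI)
    moreover have "(x + x') + \<i> \<cdot>\<^sub>v (v + v') = p + r" "(y + y') + \<i> \<cdot>\<^sub>v (w + w') = q + s"
      using car[OF pq(1)] car[OF pq(2)] car[OF pq(3)] car[OF pq(4)] unfolding e
      by (auto intro!: eq_vecI simp: algebra_simps)
    ultimately show "(p + r, q + s) \<in> complexify M" by simp
  next
    fix c :: complex and p q assume "(p, q) \<in> complexify M"
    then obtain x y v w where pq: "(x, y) \<in> M" "(v, w) \<in> M"
      and e: "p = x + \<i> \<cdot>\<^sub>v v" "q = y + \<i> \<cdot>\<^sub>v w"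
      by (auto simp: complexify_def)
    \<comment> \<open>For \<open>c = a + \<i> b\<close> the product \<open>c (x + \<i> v)\<close>
      has the parts \<open>a x - b v\<close> and \<open>b x + a v\<close>, to which closure under
      real scalars applies; \<open>?d\<close> is \<open>-b\<close>.\<close>
    let ?a = "complex_of_real (Re c)" and ?b = "complex_of_real (Im c)"
      and ?d = "complex_of_real (- Im c)"
    have "((?a \<cdot>\<^sub>v x + ?d \<cdot>\<^sub>v v) + \<i> \<cdot>\<^sub>v (?b \<cdot>\<^sub>v x + ?a \<cdot>\<^sub>v v),
        (?a \<cdot>\<^sub>v y + ?d \<cdot>\<^sub>v w) + \<i> \<cdot>\<^sub>v (?b \<cdot>\<^sub>v y + ?a \<cdot>\<^sub>v w)) \<in> complexify M"
      using comb[OF pq, of "Re c" "- Im c"] comb[OF pq, of "Im c" "Re c"] by (rule complexifyI)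
    moreover have "(?a \<cdot>\<^sub>v x + ?d \<cdot>\<^sub>v v) + \<i> \<cdot>\<^sub>v (?b \<cdot>\<^sub>v x + ?a \<cdot>\<^sub>v v) = c \<cdot>\<^sub>v p"
      "(?a \<cdot>\<^sub>v y + ?d \<cdot>\<^sub>v w) + \<i> \<cdot>\<^sub>v (?b \<cdot>\<^sub>v y + ?a \<cdot>\<^sub>v w) = c \<cdot>\<^sub>v q"
      using car[OF pq(1)] car[OF pq(2)] unfolding e
      by (auto intro!: eq_vecI simp: complex_eq_iff algebra_simps)
    ultimately show "(c \<cdot>\<^sub>v p, c \<cdot>\<^sub>v q) \<in> complexify M" by simp
  qed
qed

lemma dissipative_complexify:
  assumes "dissipative_relation \<real> n D"
  shows "dissipative_relation UNIV n (complexify D)"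
  unfolding dissipative_relation_def
proof (intro conjI ballI, goal_cases)
  case 1
  show ?case by (intro linear_relation_complexify dissipativeD(1) assms)
next
  case (2 p)
  then obtain x y v w where xy: "(x, y) \<in> D" "(v, w) \<in> D" and p: "p = (x + \<i> \<cdot>\<^sub>v v, y + \<i> \<cdot>\<^sub>v w)"
    by (auto simp: complexify_def)
  have K: "x \<in> Kvec \<real> n" "y \<in> Kvec \<real> n" "v \<in> Kvec \<real> n" "w \<in> Kvec \<real> n"
    using xy linear_relation_Kvec[OF dissipativeD(1)[OF assms]] by blast+
  have "Re (x \<bullet>c y) \<le> 0" "Re (v \<bullet>c w) \<le> 0"
    using xy by (auto intro: dissipativeD(2)[OF assms])
  then show ?case
    using real_cinner(1)[OF K(3,2)] real_cinner(1)[OF K(1,4)]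
    by (simp add: p cinner_complex_parts[OF K(1,3,2,4)[THEN Kvec_carrier]])
qed

text \<open>Symmetry of \<open>L\<close> together with symmetry of the real inner product cancels
  the imaginary part.\<close>

lemma complexify_cinner_diag:
  assumes L: "nonnegative_relation \<real> n L" and xy: "(x, y) \<in> L" and vw: "(v, w) \<in> L"
  shows "(x + \<i> \<cdot>\<^sub>v v) \<bullet>c (y + \<i> \<cdot>\<^sub>v w) = x \<bullet>c y + v \<bullet>c w"
proof -
  note K = linear_relation_Kvec[OF nonnegativeD(1)[OF L] xy] linear_relation_Kvec[OF nonnegativeD(1)[OF L] vw]
  have "v \<bullet>c y = x \<bullet>c w"
    using nonnegativeD(3)[OF L xy vw] real_cinner(2)[OF K(4,1)] by simp
  then show ?thesis by (simp add: cinner_complex_parts[OF K(1,3,2,4)[THEN Kvec_carrier]])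
qed

lemma nonnegative_complexify:
  assumes L: "nonnegative_relation \<real> n L"
  shows "nonnegative_relation UNIV n (complexify L)"
proof -
  have lin: "linear_relation UNIV n (complexify L)"
    by (intro linear_relation_complexify nonnegativeD(1) L)
  have "0 \<le> p \<bullet>c q" if "(p, q) \<in> complexify L" for p q
  proof -
    obtain x y v w where xy: "(x, y) \<in> L" "(v, w) \<in> L" and e: "p = x + \<i> \<cdot>\<^sub>v v" "q = y + \<i> \<cdot>\<^sub>v w"
      using \<open>(p, q) \<in> complexify L\<close> by (auto simp: complexify_def)
    have "0 \<le> x \<bullet>c y" "0 \<le> v \<bullet>c w" using xy by (auto intro: nonnegativeD(2)[OF L])
    then show ?thesis by (simp add: e complexify_cinner_diag[OF L xy])
  qed
  moreover have "s \<bullet>c p = r \<bullet>c q" if pr: "(p, q) \<in> complexify L" "(r, s) \<in> complexify L" for p q r s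
  proof -
    obtain x y v w x' y' v' w' where pq: "(x, y) \<in> L" "(v, w) \<in> L" "(x', y') \<in> L" "(v', w') \<in> L"
      and e: "p = x + \<i> \<cdot>\<^sub>v v" "q = y + \<i> \<cdot>\<^sub>v w" "r = x' + \<i> \<cdot>\<^sub>v v'" "s = y' + \<i> \<cdot>\<^sub>v w'"
      using pr by (auto simp: complexify_def)
    note c = pq[THEN linear_relation_Kvec(1)[OF nonnegativeD(1)[OF L]], THEN Kvec_carrier]
      pq[THEN linear_relation_Kvec(2)[OF nonnegativeD(1)[OF L]], THEN Kvec_carrier]
    show ?thesis
      unfolding e cinner_complex_parts[OF c(7,8,1,2)] cinner_complex_parts[OF c(3,4,5,6)]
      using nonnegativeD(3)[OF L pq(1) pq(3)] nonnegativeD(3)[OF L pq(1) pq(4)]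
        nonnegativeD(3)[OF L pq(2) pq(3)] nonnegativeD(3)[OF L pq(2) pq(4)] by simp
  qed
  moreover have "complexify L \<subseteq> carrier_vec n \<times> carrier_vec n"
    using linear_relationD(1)[OF lin] by simp
  ultimately show ?thesis
    using lin unfolding nonnegative_relation_def symmetric_relation_def lrel_adjoint_def Kvec_UNIV
    by fast
qed

text \<open>The intermediate vector of a complexified product is split once in \<open>L\<close> and
  once in \<open>D\<close>. Uniqueness of real and imaginary parts identifies the two splittings, so
  the real pairs compose.\<close>

lemma lrel_prod_complexify:
  assumes D: "linear_relation \<real> n D" and L: "linear_relation \<real> n L"
  shows "lrel_prod (complexify D) (complexify L) = complexify (lrel_prod D L)"
proof (intro equalityI subrelI)
  fix p q assume "(p, q) \<in> lrel_prod (complexify D) (complexify L)"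
  then obtain r where "(p, r) \<in> complexify L" "(r, q) \<in> complexify D"
    by (auto simp: lrel_prod_def)
  then obtain x y v w y' z w' t where m: "(x, y) \<in> L" "(v, w) \<in> L" "(y', z) \<in> D" "(w', t) \<in> D"
    and e: "p = x + \<i> \<cdot>\<^sub>v v" "q = z + \<i> \<cdot>\<^sub>v t" and r: "y + \<i> \<cdot>\<^sub>v w = y' + \<i> \<cdot>\<^sub>v w'"
    by (auto simp: complexify_def)
  have "y \<in> Kvec \<real> n" "w \<in> Kvec \<real> n" "y' \<in> Kvec \<real> n" "w' \<in> Kvec \<real> n"
    using m linear_relation_Kvec[OF D] linear_relation_Kvec[OF L] by blast+
  note eqs = real_decomposition_unique[OF this r]
  then show "(p, q) \<in> complexify (lrel_prod D L)"
    using m eqs unfolding e by (intro complexifyI) (auto simp: lrel_prod_def)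
next
  fix p q assume "(p, q) \<in> complexify (lrel_prod D L)"
  then obtain x y z v w t where m: "(x, y) \<in> L" "(y, z) \<in> D" "(v, w) \<in> L" "(w, t) \<in> D"
    and e: "p = x + \<i> \<cdot>\<^sub>v v" "q = z + \<i> \<cdot>\<^sub>v t"
    by (auto simp: complexify_def lrel_prod_def)
  show "(p, q) \<in> lrel_prod (complexify D) (complexify L)"
    using complexifyI[OF m(1,3)] complexifyI[OF m(2,4)] unfolding lrel_prod_def e by (rule relcompI)
qed

text \<open>Every complex vector is \<open>x + \<i> y\<close> with real \<open>x\<close>,
  \<open>y\<close>, and multiplication by a matrix is complex linear.\<close>

lemma stacked_range_complexify:
  assumes E: "E \<in> carrier_mat n n" and A: "A \<in> carrier_mat n n"
  shows "stacked_range UNIV n E A = complexify (stacked_range \<real> n E A)"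
proof (intro equalityI subrelI)
  fix p q assume "(p, q) \<in> stacked_range UNIV n E A"
  then obtain z where z: "z \<in> carrier_vec n" "p = E *\<^sub>v z" "q = A *\<^sub>v z"
    by (auto simp: stacked_range_def)
  obtain x y where xy: "x \<in> Kvec \<real> n" "y \<in> Kvec \<real> n" "z = x + \<i> \<cdot>\<^sub>v y"
    using real_decomposition[OF z(1)] by blast
  have "p = E *\<^sub>v x + \<i> \<cdot>\<^sub>v (E *\<^sub>v y)" "q = A *\<^sub>v x + \<i> \<cdot>\<^sub>v (A *\<^sub>v y)"
    using z xy E A by (simp_all add: mult_mat_vec_complex_parts Kvec_carrier)
  then show "(p, q) \<in> complexify (stacked_range \<real> n E A)"
    using xy by (auto intro!: complexifyI simp: stacked_range_def)
next
  fix p q assume "(p, q) \<in> complexify (stacked_range \<real> n E A)"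
  then obtain x y where xy: "x \<in> Kvec \<real> n" "y \<in> Kvec \<real> n"
    and "p = E *\<^sub>v x + \<i> \<cdot>\<^sub>v (E *\<^sub>v y)" "q = A *\<^sub>v x + \<i> \<cdot>\<^sub>v (A *\<^sub>v y)"
    by (auto simp: complexify_def stacked_range_def)
  then have "p = E *\<^sub>v (x + \<i> \<cdot>\<^sub>v y)" "q = A *\<^sub>v (x + \<i> \<cdot>\<^sub>v y)" "x + \<i> \<cdot>\<^sub>v y \<in> carrier_vec n"
    using E A by (simp_all add: mult_mat_vec_complex_parts Kvec_carrier)
  then show "(p, q) \<in> stacked_range UNIV n E A"
    unfolding stacked_range_def Kvec_UNIV by blast
qed

section \<open>Definite relations and assembly of the theorem\<close>

text \<open>Requiring both components to vanish covers the hypotheses \<open>definite\<close> and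
  \<open>inj\<close> of the chain lemmas at once and passes to the complexification.\<close>

definition definite_relation :: "nat \<Rightarrow> lrel \<Rightarrow> bool" where
  "definite_relation n L \<longleftrightarrow> (\<forall>(z, y)\<in>L. z \<bullet>c y = 0 \<longrightarrow> z = 0\<^sub>v n \<and> y = 0\<^sub>v n)"

lemma definite_graph_inverse:
  assumes "positive_definite K n M"
  shows "definite_relation n ((graph K n M)\<inverse>)"
  unfolding definite_relation_def
proof (clarify, goal_cases)
  case (1 z y)
  then have y: "y \<in> Kvec K n" "z = M *\<^sub>v y" by (auto simp: graph_def)
  then have "y = 0\<^sub>v n" using assms 1 by (force simp: positive_definite_def)
  moreover have "M \<in> carrier_mat n n" using assms by (simp add: positive_definite_def Kmat_def)
  ultimately show ?case using y by (auto intro!: eq_vecI)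
qed

text \<open>By \<open>complexify_cinner_diag\<close> the form is a sum of two nonnegative numbers,
  so if it vanishes both summands do.\<close>

lemma definite_complexify:
  assumes L: "nonnegative_relation \<real> n L" and d: "definite_relation n L"
  shows "definite_relation n (complexify L)"
  unfolding definite_relation_def
proof (clarify, goal_cases)
  case (1 p q)
  then obtain x y v w where xy: "(x, y) \<in> L" "(v, w) \<in> L" and e: "p = x + \<i> \<cdot>\<^sub>v v" "q = y + \<i> \<cdot>\<^sub>v w"
    by (auto simp: complexify_def)
  have "0 \<le> x \<bullet>c y" "0 \<le> v \<bullet>c w" using xy by (auto intro: nonnegativeD(2)[OF L])
  moreover have "x \<bullet>c y + v \<bullet>c w = 0" using 1 by (simp add: e complexify_cinner_diag[OF L xy])
  ultimately have "x \<bullet>c y = 0" "v \<bullet>c w = 0" by (auto simp: add_nonneg_eq_0_iff)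
  then have "x = 0\<^sub>v n" "y = 0\<^sub>v n" "v = 0\<^sub>v n" "w = 0\<^sub>v n"
    using d xy unfolding definite_relation_def by blast+
  then show ?case by (simp add: e)
qed

theorem proposition6p3:
  fixes K :: "complex set" and n :: nat
    and E A :: "complex mat"
    and D L :: lrel
  assumes "K = \<real> \<or> K = UNIV"
    and "E \<in> Kmat K n" and "A \<in> Kmat K n"
    and "dissipative_relation K n D"
    and "nonnegative_relation K n L"
    and "stacked_range K n E A = lrel_prod D L"
    and "regular_pencil E A"
  shows
    "(pencil_eigenvalues E A \<subseteq> {\<mu>. Re \<mu> \<le> 0} \<and>
      (\<forall>\<mu>\<in>pencil_eigenvalues E A. \<mu> \<noteq> 0 \<and> Re \<mu> = 0 \<longrightarrow> semi_simple n E A \<mu>) \<and>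
      (\<forall>k. jordan_block_at n E A 0 k \<longrightarrow> k \<le> 2)) \<and>
     ((\<forall>k. jordan_block_at_infinity n E A k \<longrightarrow> k \<le> 3) \<and> pencil_index n E A \<le> 3) \<and>
     (maximally_dissipative_relation K n D \<and>
        (\<exists>M. positive_definite K n M \<and> L = (graph K n M)\<inverse>) \<longrightarrow>
      pencil_index n E A \<le> 1 \<and>
      (0 \<in> pencil_eigenvalues E A \<longrightarrow> semi_simple n E A 0))"
proof -
  have car: "E \<in> carrier_mat n n" "A \<in> carrier_mat n n"
    using assms by (auto simp: Kmat_def)
  \<comment> \<open>Definiteness is carried along as an implication, so that a single interpretation
    of the locale serves all three claims over both fields.\<close>
  have "\<exists>D' L'. dissipative_pencil n E A D' L' \<and> (definite_relation n L \<longrightarrow> definite_relation n L')"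
    using assms(1)
  proof
    assume K: "K = \<real>"
    have "linear_relation \<real> n D" "linear_relation \<real> n L"
      using dissipativeD(1)[OF assms(4)] nonnegativeD(1)[OF assms(5)] K by simp_all
    then have "stacked_range UNIV n E A = lrel_prod (complexify D) (complexify L)"
      using assms(6) K car by (simp add: stacked_range_complexify lrel_prod_complexify)
    then have "dissipative_pencil n E A (complexify D) (complexify L)"
      using assms K car by (simp add: dissipative_pencil_def dissipative_complexify nonnegative_complexify)
    then show ?thesis using definite_complexify assms(5) K by blast
  next
    assume "K = UNIV"
    then have "dissipative_pencil n E A D L" using assms car by (simp add: dissipative_pencil_def)
    then show ?thesis by blast
  qed
  then obtain D' L' where P: "dissipative_pencil n E A D' L'"
    and def: "definite_relation n L \<Longrightarrow> definite_relation n L'" by blast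
  interpret dissipative_pencil n E A D' L' by (rule P)
  have "pencil_index n E A \<le> 1 \<and> semi_simple n E A 0"
    if "positive_definite K n M" "L = (graph K n M)\<inverse>" for M
  proof -
    have "definite_relation n L'" using definite_graph_inverse that def by blast
    \<comment> \<open>For a pair \<open>(0, y)\<close> the form is zero, so definiteness also yields
      \<open>y = 0\<close>.\<close>
    then have "\<forall>(z, y)\<in>L'. z \<bullet>c y = 0 \<longrightarrow> z = 0\<^sub>v n" "\<forall>y. (0\<^sub>v n, y) \<in> L' \<longrightarrow> y = 0\<^sub>v n"
      using L_carrier(2) by (fastforce simp: definite_relation_def)+
    then show ?thesis
      by (intro conjI definite_semi_simple_zero pencil_index_le) (rule definite_block_at_infinity_le)
  qed
  moreover have "pencil_index n E A \<le> 3"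
    using block_at_infinity_le by (rule pencil_index_le)
  ultimately show ?thesis
    using eigenvalue_Re_le semi_simple_imaginary block_at_zero_le block_at_infinity_le
    by (intro conjI ballI allI impI subsetI CollectI) auto
qed

end
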